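(* Let $X=\ell_p$ (complex sequences indexed by $\mathbb Z_+$) with $2<p<\infty$. If $\mathcal G\subseteq\mathcal B_1(X)$ is an $\mathrm{SOT}^*$-$G_\delta$ set which is SOT-dense in $\mathcal B_1(X)$, then $\mathcal G$ is SOT-comeager in $\mathcal B_1(X)$. Therefore, any $\mathrm{SOT}^*$-comeager subset of $\mathcal B_1(X)$ is SOT-comeager in $\mathcal B_1(X)$ as well.
   Context: $\mathcal B_1(X)$ is the set of all bounded linear operators $T$ on $X$ with $\|T\|\le 1$. SOT is the topology of pointwise norm convergence on $X$. $\mathrm{SOT}^*$ is the topology of pointwise norm convergence of operators and of their adjoints: $T_i\to T$ iff $T_ix\to Tx$ for all $x\in X$ and $T_i^*x^*\to T^*x^*$ for all $x^*\in X^*$, in norm. Both topologies turn $\mathcal B_1(X)$ into a Polish space. For $\tau\in\{\mathrm{SOT},\mathrm{SOT}^*\}$, a set is $\tau$-$G_\delta$, resp. $\tau$-comeager, if it is a $G_\delta$ subset of $(\mathcal B_1(X),\tau)$, resp. contains a dense $G_\delta$ subset of $(\mathcal B_1(X),\tau)$. *)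

theory Defs
  imports "HOL-Analysis.Analysis"
begin

section \<open>The complex sequence spaces \<open>\<ell>\<^sub>p\<close>\<close>

text \<open>
  The exponent is a real parameter, so \<open>\<ell>\<^sub>p\<close> is a carrier set inside \<^typ>\<open>nat \<Rightarrow> complex\<close>
  with pointwise operations.
\<close>

definition lp :: "real \<Rightarrow> (nat \<Rightarrow> complex) set" where
  "lp p = {x. summable (\<lambda>n. norm (x n) powr p)}"

definition lp_norm :: "real \<Rightarrow> (nat \<Rightarrow> complex) \<Rightarrow> real" where
  "lp_norm p x = (\<Sum>n. norm (x n) powr p) powr (1 / p)"

definition lp_dist :: "real \<Rightarrow> (nat \<Rightarrow> complex) \<Rightarrow> (nat \<Rightarrow> complex) \<Rightarrow> real" where
  "lp_dist p x y = lp_norm p (\<lambda>n. x n - y n)"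

abbreviation lp_topology :: "real \<Rightarrow> (nat \<Rightarrow> complex) topology" where
  "lp_topology p \<equiv> Metric_space.mtopology (lp p) (lp_dist p)"

abbreviation lp_ball :: "real \<Rightarrow> (nat \<Rightarrow> complex) set" where
  "lp_ball p \<equiv> {x \<in> lp p. lp_norm p x \<le> 1}"


section \<open>Bounded operators and bounded functionals\<close>

text \<open>
  Maps defined on \<open>\<ell>\<^sub>p\<close> are represented extensionally (via \<open>\<rightarrow>\<^sub>E\<close>): they take the value
  \<^const>\<open>undefined\<close> outside \<^term>\<open>lp p\<close>, so that equality of maps is equality on \<open>\<ell>\<^sub>p\<close>.
\<close>

definition lp_operators :: "real \<Rightarrow> ((nat \<Rightarrow> complex) \<Rightarrow> (nat \<Rightarrow> complex)) set" where
  "lp_operators p =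
    {T \<in> lp p \<rightarrow>\<^sub>E lp p.
       (\<forall>x\<in>lp p. \<forall>y\<in>lp p. T (\<lambda>n. x n + y n) = (\<lambda>n. T x n + T y n)) \<and>
       (\<forall>c. \<forall>x\<in>lp p. T (\<lambda>n. c * x n) = (\<lambda>n. c * T x n)) \<and>
       (\<exists>C. \<forall>x\<in>lp p. lp_norm p (T x) \<le> C * lp_norm p x)}"

definition lp_opnorm :: "real \<Rightarrow> ((nat \<Rightarrow> complex) \<Rightarrow> (nat \<Rightarrow> complex)) \<Rightarrow> real" where
  "lp_opnorm p T = (SUP x\<in>lp_ball p. lp_norm p (T x))"

definition lp_contractions :: "real \<Rightarrow> ((nat \<Rightarrow> complex) \<Rightarrow> (nat \<Rightarrow> complex)) set" where
  "lp_contractions p = {T \<in> lp_operators p. lp_opnorm p T \<le> 1}"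

definition lp_dual :: "real \<Rightarrow> ((nat \<Rightarrow> complex) \<Rightarrow> complex) set" where
  "lp_dual p =
    {f \<in> lp p \<rightarrow>\<^sub>E UNIV.
       (\<forall>x\<in>lp p. \<forall>y\<in>lp p. f (\<lambda>n. x n + y n) = f x + f y) \<and>
       (\<forall>c. \<forall>x\<in>lp p. f (\<lambda>n. c * x n) = c * f x) \<and>
       (\<exists>C. \<forall>x\<in>lp p. norm (f x) \<le> C * lp_norm p x)}"

definition lp_dual_norm :: "real \<Rightarrow> ((nat \<Rightarrow> complex) \<Rightarrow> complex) \<Rightarrow> real" where
  "lp_dual_norm p f = (SUP x\<in>lp_ball p. norm (f x))"

text \<open>
  \<^locale>\<open>Metric_space\<close> asks for nonnegativity on the whole type, so the distance is set to
  \<open>0\<close> outside the carrier, where the supremum is not meaningful.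
\<close>

definition lp_dual_dist ::
    "real \<Rightarrow> ((nat \<Rightarrow> complex) \<Rightarrow> complex) \<Rightarrow> ((nat \<Rightarrow> complex) \<Rightarrow> complex) \<Rightarrow> real" where
  "lp_dual_dist p f g =
    (if f \<in> lp_dual p \<and> g \<in> lp_dual p then lp_dual_norm p (\<lambda>x. f x - g x) else 0)"

abbreviation lp_dual_topology :: "real \<Rightarrow> ((nat \<Rightarrow> complex) \<Rightarrow> complex) topology" where
  "lp_dual_topology p \<equiv> Metric_space.mtopology (lp_dual p) (lp_dual_dist p)"

definition lp_adjoint ::
    "real \<Rightarrow> ((nat \<Rightarrow> complex) \<Rightarrow> (nat \<Rightarrow> complex)) \<Rightarrow>
      ((nat \<Rightarrow> complex) \<Rightarrow> complex) \<Rightarrow> ((nat \<Rightarrow> complex) \<Rightarrow> complex)" where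
  "lp_adjoint p T = (\<lambda>f\<in>lp_dual p. \<lambda>x\<in>lp p. f (T x))"


section \<open>The operator topologies on the unit ball\<close>

text \<open>
  \<^term>\<open>lp_SOT_star p\<close> is the initial topology for the maps \<open>T \<mapsto> T x\<close> (\<open>x\<close> in \<open>\<ell>\<^sub>p\<close>) and
  \<open>T \<mapsto> T\<^sup>* f\<close> (\<open>f\<close> in the dual); the lemmas \<open>limitin_lp_SOT\<close> and \<open>limitin_lp_SOT_star\<close>
  below describe convergence in both topologies.
\<close>

definition lp_SOT :: "real \<Rightarrow> ((nat \<Rightarrow> complex) \<Rightarrow> (nat \<Rightarrow> complex)) topology" where
  "lp_SOT p = subtopology (product_topology (\<lambda>x. lp_topology p) (lp p)) (lp_contractions p)"

definition lp_SOT_star :: "real \<Rightarrow> ((nat \<Rightarrow> complex) \<Rightarrow> (nat \<Rightarrow> complex)) topology" where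
  "lp_SOT_star p =
    pullback_topology (lp_contractions p) (\<lambda>T. (T, lp_adjoint p T))
      (prod_topology
        (product_topology (\<lambda>x. lp_topology p) (lp p))
        (product_topology (\<lambda>f. lp_dual_topology p) (lp_dual p)))"


section \<open>Comeager sets\<close>

definition dense_in :: "'a topology \<Rightarrow> 'a set \<Rightarrow> bool" where
  "dense_in X A \<longleftrightarrow> A \<subseteq> topspace X \<and> X closure_of A = topspace X"

definition comeager_in :: "'a topology \<Rightarrow> 'a set \<Rightarrow> bool" where
  "comeager_in X A \<longleftrightarrow> A \<subseteq> topspace X \<and> (\<exists>G. gdelta_in X G \<and> dense_in X G \<and> G \<subseteq> A)"


section \<open>Basic facts about the definitions\<close>

lemma powr_convex_nonneg:
  fixes x y u v p :: real
  assumes "p \<ge> 1" "x \<ge> 0" "y \<ge> 0" "u \<ge> 0" "v \<ge> 0" "u + v = 1"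
  shows "(u * x + v * y) powr p \<le> u * x powr p + v * y powr p"
proof -
  have scale: "(t * z) powr p \<le> t * z powr p" if "0 \<le> t" "t \<le> 1" "0 \<le> z" for t z :: real
  proof -
    have "t powr p \<le> t"
      using powr_mono'[of 1 p t] that assms by (cases "t = 0") auto
    then show ?thesis using that by (simp add: powr_mult mult_right_mono)
  qed
  consider "x = 0" | "y = 0" | "x > 0" "y > 0" using assms by linarith
  then show ?thesis
  proof cases
    case 1
    then show ?thesis using scale[of v y] assms by simp
  next
    case 2
    then show ?thesis using scale[of u x] assms by simp
  next
    case 3
    have "convex_on {0<..} (\<lambda>x. x powr p)" using powr_convex assms by blast
    then have "((1 - v) * x + v * y) powr p \<le> (1 - v) * x powr p + v * y powr p"
      using convex_onD[of "{0<..}" "\<lambda>x. x powr p" v x y] 3 assms by simp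
    moreover have "1 - v = u" using assms by simp
    ultimately show ?thesis by simp
  qed
qed

lemma lp_norm_nonneg [simp]: "lp_norm p x \<ge> 0"
  by (simp add: lp_norm_def)

lemma lp_zero [simp]: "(\<lambda>n. 0) \<in> lp p"
  by (simp add: lp_def)

lemma lp_norm_zero [simp]: "lp_norm p (\<lambda>n. 0) = 0"
  by (simp add: lp_norm_def)

lemma lp_norm_powr:
  assumes "p \<ge> 1" "x \<in> lp p"
  shows "lp_norm p x powr p = (\<Sum>n. norm (x n) powr p)"
proof -
  have "(\<Sum>n. norm (x n) powr p) \<ge> 0"
    using assms by (intro suminf_nonneg) (auto simp: lp_def)
  then show ?thesis using assms by (simp add: lp_norm_def powr_powr)
qed

lemma lp_norm_eq_0:
  assumes "p \<ge> 1" "x \<in> lp p"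
  shows "lp_norm p x = 0 \<longleftrightarrow> x = (\<lambda>n. 0)"
proof
  assume "lp_norm p x = 0"
  then have "(\<Sum>n. norm (x n) powr p) = 0" using lp_norm_powr[OF assms] by simp
  then have "\<forall>n. norm (x n) powr p = 0"
    using assms by (subst (asm) suminf_eq_zero_iff) (auto simp: lp_def)
  then show "x = (\<lambda>n. 0)" by auto
qed simp

lemma lp_scale:
  assumes "p \<ge> 1" "x \<in> lp p"
  shows "(\<lambda>n. c * x n) \<in> lp p" "lp_norm p (\<lambda>n. c * x n) = norm c * lp_norm p x"
proof -
  have s: "summable (\<lambda>n. norm (x n) powr p)" using assms by (simp add: lp_def)
  have eq: "norm (c * x n) powr p = norm c powr p * norm (x n) powr p" for n
    by (simp add: norm_mult powr_mult)
  show "(\<lambda>n. c * x n) \<in> lp p"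
    unfolding lp_def mem_Collect_eq eq by (rule summable_mult[OF s])
  have "(\<Sum>n. norm (x n) powr p) \<ge> 0" using s by (intro suminf_nonneg) auto
  then show "lp_norm p (\<lambda>n. c * x n) = norm c * lp_norm p x"
    unfolding lp_norm_def eq suminf_mult[OF s] using assms(1)
    by (simp add: powr_mult powr_powr)
qed

lemma lp_add_aux:
  assumes "p \<ge> 1" "x \<in> lp p" "y \<in> lp p" and a: "a > 0" "lp_norm p x \<le> a" and b: "b > 0" "lp_norm p y \<le> b"
  shows "(\<lambda>n. x n + y n) \<in> lp p \<and> lp_norm p (\<lambda>n. x n + y n) \<le> a + b"
proof -
  define u where "u = a / (a + b)"
  define v where "v = b / (a + b)"
  have uv: "u \<ge> 0" "v \<ge> 0" "u + v = 1"
    using a b by (auto simp: u_def v_def simp flip: add_divide_distrib)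
  define B where "B n = (a + b) powr p * (u * (norm (x n) powr p / a powr p) + v * (norm (y n) powr p / b powr p))" for n
  have sx: "summable (\<lambda>n. norm (x n) powr p)" and sy: "summable (\<lambda>n. norm (y n) powr p)"
    using assms by (auto simp: lp_def)
  have le: "norm (x n + y n) powr p \<le> B n" for n
  proof -
    have "norm (x n + y n) \<le> (a + b) * (u * (norm (x n) / a) + v * (norm (y n) / b))"
    proof -
      have "(a + b) * u = a" "(a + b) * v = b" using a b by (auto simp: u_def v_def)
      then have "(a + b) * (u * (norm (x n) / a) + v * (norm (y n) / b)) =
          a * (norm (x n) / a) + b * (norm (y n) / b)"
        by (simp only: distrib_left mult.assoc[symmetric])
      also have "\<dots> = norm (x n) + norm (y n)" using a b by simp
      finally show ?thesis using norm_triangle_ineq[of "x n" "y n"] by simp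
    qed
    then have "norm (x n + y n) powr p \<le> ((a + b) * (u * (norm (x n) / a) + v * (norm (y n) / b))) powr p"
      using assms(1) by (intro powr_mono2) auto
    also have "\<dots> = (a + b) powr p * (u * (norm (x n) / a) + v * (norm (y n) / b)) powr p"
      by (rule powr_mult)
    also have "\<dots> \<le> (a + b) powr p * (u * (norm (x n) / a) powr p + v * (norm (y n) / b) powr p)"
      using a b uv assms(1) by (intro mult_left_mono powr_convex_nonneg) auto
    also have "\<dots> = B n" using a b by (simp add: B_def powr_divide)
    finally show ?thesis .
  qed
  have sB: "summable B"
    unfolding B_def by (intro summable_mult summable_add summable_divide sx sy)
  have sum: "summable (\<lambda>n. norm (x n + y n) powr p)"
    by (rule summable_comparison_test'[OF sB]) (use le in auto)
  have "(\<Sum>n. norm (x n) powr p) = lp_norm p x powr p" by (simp add: lp_norm_powr assms)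
  also have "\<dots> \<le> a powr p" using assms by (intro powr_mono2) auto
  finally have X: "(\<Sum>n. norm (x n) powr p) / a powr p \<le> 1" using a by simp
  have "(\<Sum>n. norm (y n) powr p) = lp_norm p y powr p" by (simp add: lp_norm_powr assms)
  also have "\<dots> \<le> b powr p" using assms by (intro powr_mono2) auto
  finally have Y: "(\<Sum>n. norm (y n) powr p) / b powr p \<le> 1" using b by simp
  have "(\<Sum>n. norm (x n + y n) powr p) \<le> suminf B"
    by (rule suminf_le[OF le sum sB])
  also have "suminf B = (a + b) powr p * (u * ((\<Sum>n. norm (x n) powr p) / a powr p) + v * ((\<Sum>n. norm (y n) powr p) / b powr p))"
  proof -
    have "(\<lambda>n. norm (x n) powr p) sums (\<Sum>n. norm (x n) powr p)"
      "(\<lambda>n. norm (y n) powr p) sums (\<Sum>n. norm (y n) powr p)"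
      using sx sy by (simp_all add: summable_sums)
    then have "B sums ((a + b) powr p * (u * ((\<Sum>n. norm (x n) powr p) / a powr p)
        + v * ((\<Sum>n. norm (y n) powr p) / b powr p)))"
      unfolding B_def by (intro sums_mult sums_add sums_divide)
    then show ?thesis by (simp add: sums_iff)
  qed
  also have "\<dots> \<le> (a + b) powr p * (u * 1 + v * 1)"
    using X Y uv by (intro mult_left_mono add_mono) auto
  finally have "(\<Sum>n. norm (x n + y n) powr p) \<le> (a + b) powr p" using uv by simp
  moreover have "(\<Sum>n. norm (x n + y n) powr p) \<ge> 0" using sum by (intro suminf_nonneg) auto
  ultimately have "(\<Sum>n. norm (x n + y n) powr p) powr (1 / p) \<le> ((a + b) powr p) powr (1 / p)"
    using assms(1) by (intro powr_mono2) auto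
  also have "\<dots> = a + b" using a b assms(1) by (simp add: powr_powr)
  finally show ?thesis using sum by (simp add: lp_norm_def lp_def)
qed

lemma lp_add:
  assumes "p \<ge> 1" "x \<in> lp p" "y \<in> lp p"
  shows "(\<lambda>n. x n + y n) \<in> lp p" "lp_norm p (\<lambda>n. x n + y n) \<le> lp_norm p x + lp_norm p y"
proof -
  have *: "(\<lambda>n. x n + y n) \<in> lp p \<and> lp_norm p (\<lambda>n. x n + y n) \<le> (lp_norm p x + e) + (lp_norm p y + e)"
    if "e > 0" for e
    using that lp_norm_nonneg[of p x] lp_norm_nonneg[of p y]
    by (intro lp_add_aux assms) linarith+
  show "(\<lambda>n. x n + y n) \<in> lp p" using *[of 1] by simp
  show "lp_norm p (\<lambda>n. x n + y n) \<le> lp_norm p x + lp_norm p y"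
  proof (rule field_le_epsilon)
    fix e :: real assume "e > 0"
    then show "lp_norm p (\<lambda>n. x n + y n) \<le> lp_norm p x + lp_norm p y + e"
      using *[of "e / 2"] by simp
  qed
qed

lemma lp_diff:
  assumes "p \<ge> 1" "x \<in> lp p" "y \<in> lp p"
  shows "(\<lambda>n. x n - y n) \<in> lp p"
  using lp_add(1)[OF assms(1,2) lp_scale(1)[OF assms(1,3), of "-1"]] by simp

lemma Metric_space_lp:
  assumes "p \<ge> 1"
  shows "Metric_space (lp p) (lp_dist p)"
proof
  show "0 \<le> lp_dist p x y" for x y by (simp add: lp_dist_def)
  show "lp_dist p x y = lp_dist p y x" for x y
    by (simp add: lp_dist_def lp_norm_def norm_minus_commute)
  show "lp_dist p x y = 0 \<longleftrightarrow> x = y" if "x \<in> lp p" "y \<in> lp p" for x y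
    using lp_norm_eq_0[OF assms lp_diff[OF assms that]] by (auto simp: lp_dist_def fun_eq_iff)
  show "lp_dist p x z \<le> lp_dist p x y + lp_dist p y z"
    if "x \<in> lp p" "y \<in> lp p" "z \<in> lp p" for x y z
    using lp_add(2)[OF assms lp_diff[OF assms that(1,2)] lp_diff[OF assms that(2,3)]]
    by (simp add: lp_dist_def)
qed

lemma lp_dual_bdd_above:
  assumes "f \<in> lp_dual p" "g \<in> lp_dual p"
  shows "bdd_above ((\<lambda>x. norm (f x - g x)) ` lp_ball p)"
proof -
  obtain C D where C: "\<forall>x\<in>lp p. norm (f x) \<le> C * lp_norm p x"
    and D: "\<forall>x\<in>lp p. norm (g x) \<le> D * lp_norm p x"
    using assms by (auto simp: lp_dual_def)
  show ?thesis
  proof (rule bdd_aboveI2)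
    fix x assume x: "x \<in> lp_ball p"
    have "C * lp_norm p x \<le> \<bar>C\<bar> * 1" "D * lp_norm p x \<le> \<bar>D\<bar> * 1"
      using x by (intro mult_mono; simp)+
    moreover have "norm (f x) \<le> C * lp_norm p x" "norm (g x) \<le> D * lp_norm p x"
      using x C D by auto
    ultimately show "norm (f x - g x) \<le> \<bar>C\<bar> + \<bar>D\<bar>"
      using norm_triangle_ineq4[of "f x" "g x"] by linarith
  qed
qed

lemma lp_dual_dist_upper:
  assumes "f \<in> lp_dual p" "g \<in> lp_dual p" "x \<in> lp_ball p"
  shows "norm (f x - g x) \<le> lp_dual_dist p f g"
  using cSUP_upper[OF assms(3) lp_dual_bdd_above[OF assms(1,2)]] assms
  by (simp add: lp_dual_dist_def lp_dual_norm_def)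

lemma lp_dual_dist_least:
  assumes "f \<in> lp_dual p" "g \<in> lp_dual p" "\<And>x. x \<in> lp_ball p \<Longrightarrow> norm (f x - g x) \<le> c"
  shows "lp_dual_dist p f g \<le> c"
proof -
  have "(\<lambda>n. 0) \<in> lp_ball p" by simp
  then have "lp_ball p \<noteq> {}" by blast
  then have "(SUP x\<in>lp_ball p. norm (f x - g x)) \<le> c"
    using assms(3) by (rule cSUP_least)
  then show ?thesis using assms(1,2) by (simp add: lp_dual_dist_def lp_dual_norm_def)
qed

lemma Metric_space_lp_dual:
  assumes "p \<ge> 1"
  shows "Metric_space (lp_dual p) (lp_dual_dist p)"
proof
  show nonneg: "0 \<le> lp_dual_dist p f g" for f g
  proof (cases "f \<in> lp_dual p \<and> g \<in> lp_dual p")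
    case True
    then have "norm (f (\<lambda>n. 0) - g (\<lambda>n. 0)) \<le> lp_dual_dist p f g"
      by (intro lp_dual_dist_upper) auto
    then show ?thesis by (meson norm_ge_zero order_trans)
  qed (auto simp: lp_dual_dist_def)
  show "lp_dual_dist p f g = lp_dual_dist p g f" for f g
    by (simp add: lp_dual_dist_def lp_dual_norm_def norm_minus_commute)
  show "lp_dual_dist p f g = 0 \<longleftrightarrow> f = g" if fg: "f \<in> lp_dual p" "g \<in> lp_dual p" for f g
  proof
    assume 0: "lp_dual_dist p f g = 0"
    show "f = g"
    proof
      fix x
      show "f x = g x"
      proof (cases "x \<in> lp p")
        case False
        then show ?thesis using fg by (auto simp: lp_dual_def PiE_def extensional_def)
      next
        case True
        define c where "c = complex_of_real (inverse (lp_norm p x + 1))"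
        have pos: "lp_norm p x + 1 > 0" using lp_norm_nonneg[of p x] by linarith
        then have c: "c \<noteq> 0" "norm c = inverse (lp_norm p x + 1)"
          by (simp_all only: c_def norm_of_real of_real_eq_0_iff) auto
        have "norm c * lp_norm p x \<le> 1"
          unfolding c(2) using pos by (simp add: divide_simps)
        then have "(\<lambda>n. c * x n) \<in> lp_ball p"
          using lp_scale[OF assms True, of c] by simp
        then have "norm (f (\<lambda>n. c * x n) - g (\<lambda>n. c * x n)) \<le> 0"
          using lp_dual_dist_upper[OF fg] 0 by fastforce
        moreover have "f (\<lambda>n. c * x n) = c * f x" "g (\<lambda>n. c * x n) = c * g x"
          using fg True by (auto simp: lp_dual_def)
        ultimately show ?thesis using c by simp
      qed
    qed
  next
    assume "f = g"
    then have "lp_dual_dist p f g \<le> 0" using fg by (intro lp_dual_dist_least) auto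
    then show "lp_dual_dist p f g = 0" using nonneg[of f g] by linarith
  qed
  show "lp_dual_dist p f h \<le> lp_dual_dist p f g + lp_dual_dist p g h"
    if "f \<in> lp_dual p" "g \<in> lp_dual p" "h \<in> lp_dual p" for f g h
  proof (rule lp_dual_dist_least[OF that(1,3)])
    fix x assume x: "x \<in> lp_ball p"
    have "norm (f x - h x) \<le> norm (f x - g x) + norm (g x - h x)"
      using norm_triangle_ineq[of "f x - g x" "g x - h x"] by simp
    then show "norm (f x - h x) \<le> lp_dual_dist p f g + lp_dual_dist p g h"
      using lp_dual_dist_upper[OF that(1,2) x] lp_dual_dist_upper[OF that(2,3) x] by linarith
  qed
qed

lemma lp_adjoint_in_dual:
  assumes "p \<ge> 1" "T \<in> lp_operators p" "f \<in> lp_dual p"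
  shows "lp_adjoint p T f \<in> lp_dual p"
proof -
  obtain C D where C: "\<forall>x\<in>lp p. lp_norm p (T x) \<le> C * lp_norm p x"
    and D: "\<forall>x\<in>lp p. norm (f x) \<le> D * lp_norm p x"
    using assms by (auto simp: lp_dual_def lp_operators_def)
  have T: "T x \<in> lp p" if "x \<in> lp p" for x using assms that by (auto simp: lp_operators_def)
  have bound: "norm (f (T x)) \<le> (\<bar>D\<bar> * C) * lp_norm p x" if "x \<in> lp p" for x
  proof -
    have "norm (f (T x)) \<le> D * lp_norm p (T x)" using D T that by blast
    also have "\<dots> \<le> \<bar>D\<bar> * lp_norm p (T x)" by (intro mult_right_mono) auto
    also have "\<dots> \<le> \<bar>D\<bar> * (C * lp_norm p x)" using C that by (intro mult_left_mono) auto
    finally show ?thesis by simp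
  qed
  have add: "f (T (\<lambda>n. x n + y n)) = f (T x) + f (T y)" if "x \<in> lp p" "y \<in> lp p" for x y
    using assms T that by (simp add: lp_dual_def lp_operators_def)
  have scale: "f (T (\<lambda>n. c * x n)) = c * f (T x)" if "x \<in> lp p" for x c
    using assms T that by (simp add: lp_dual_def lp_operators_def)
  have "lp_adjoint p T f = (\<lambda>x\<in>lp p. f (T x))" using assms(3) by (simp add: lp_adjoint_def)
  then show ?thesis
    using add scale bound lp_add(1)[OF assms(1)] lp_scale(1)[OF assms(1)]
    by (auto simp: lp_dual_def intro!: exI[of _ "\<bar>D\<bar> * C"])
qed

lemma topspace_lp_topology: "p \<ge> 1 \<Longrightarrow> topspace (lp_topology p) = lp p"
  by (simp add: Metric_space.topspace_mtopology Metric_space_lp)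

lemma topspace_lp_dual_topology: "p \<ge> 1 \<Longrightarrow> topspace (lp_dual_topology p) = lp_dual p"
  by (simp add: Metric_space.topspace_mtopology Metric_space_lp_dual)

lemma lp_contractions_PiE: "lp_contractions p \<subseteq> lp p \<rightarrow>\<^sub>E lp p"
  by (auto simp: lp_contractions_def lp_operators_def)

lemma lp_adjoint_PiE:
  "p \<ge> 1 \<Longrightarrow> T \<in> lp_contractions p \<Longrightarrow> lp_adjoint p T \<in> lp_dual p \<rightarrow>\<^sub>E lp_dual p"
  using lp_adjoint_in_dual[of p T]
  by (auto simp: lp_contractions_def PiE_iff extensional_def lp_adjoint_def)

lemma topspace_lp_SOT: "p \<ge> 1 \<Longrightarrow> topspace (lp_SOT p) = lp_contractions p"
  using lp_contractions_PiE[of p] by (auto simp: lp_SOT_def topspace_lp_topology)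

lemma topspace_lp_SOT_star: "p \<ge> 1 \<Longrightarrow> topspace (lp_SOT_star p) = lp_contractions p"
  using lp_contractions_PiE[of p] lp_adjoint_PiE[of p]
  by (auto simp: lp_SOT_star_def topspace_pullback_topology topspace_lp_topology
      topspace_lp_dual_topology)

lemma limitin_pullback_topology:
  "limitin (pullback_topology A f X) g l F \<longleftrightarrow>
     l \<in> A \<and> eventually (\<lambda>i. g i \<in> A) F \<and> limitin X (\<lambda>i. f (g i)) (f l) F"
  (is "?L \<longleftrightarrow> ?R")
proof
  assume L: ?L
  then have l: "l \<in> A" "f l \<in> topspace X"
    by (auto simp: limitin_def topspace_pullback_topology)
  have *: "eventually (\<lambda>i. f (g i) \<in> U \<and> g i \<in> A) F" if "openin X U" "f l \<in> U" for U
  proof -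
    have "openin (pullback_topology A f X) (f -` U \<inter> A)"
      using that by (auto simp: openin_pullback_topology)
    then have "eventually (\<lambda>i. g i \<in> f -` U \<inter> A) F" using L l that by (auto simp: limitin_def)
    then show ?thesis by simp
  qed
  show ?R
    unfolding limitin_def
  proof (intro conjI allI impI)
    show "eventually (\<lambda>i. g i \<in> A) F"
      using *[OF openin_topspace l(2)] by (rule eventually_mono) simp
    show "eventually (\<lambda>i. f (g i) \<in> U) F" if "openin X U \<and> f l \<in> U" for U
      using *[of U] that by (auto elim: eventually_mono)
  qed (use l in auto)
next
  assume R: ?R
  show ?L
    unfolding limitin_def
  proof (intro conjI allI impI)
    show "l \<in> topspace (pullback_topology A f X)"
      using R by (auto simp: limitin_def topspace_pullback_topology)
    fix V assume "openin (pullback_topology A f X) V \<and> l \<in> V"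
    then obtain U where U: "openin X U" "V = f -` U \<inter> A" "f l \<in> U"
      by (auto simp: openin_pullback_topology)
    then have "eventually (\<lambda>i. f (g i) \<in> U) F" using R by (auto simp: limitin_def)
    with R have "eventually (\<lambda>i. f (g i) \<in> U \<and> g i \<in> A) F"
      by (auto intro: eventually_conj)
    then show "eventually (\<lambda>i. g i \<in> V) F" using U by simp
  qed
qed

lemma limitin_lp_operators:
  assumes "p \<ge> 1" "L \<in> lp_contractions p" "eventually (\<lambda>i. T i \<in> lp_contractions p) F"
  shows "limitin (product_topology (\<lambda>x. lp_topology p) (lp p)) T L F \<longleftrightarrow>
    (\<forall>x\<in>lp p. ((\<lambda>i. lp_dist p (T i x) (L x)) \<longlongrightarrow> 0) F)"
proof -
  interpret Metric_space "lp p" "lp_dist p" using Metric_space_lp[OF assms(1)] .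
  have L: "L \<in> extensional (lp p)" "\<And>x. x \<in> lp p \<Longrightarrow> L x \<in> lp p"
    using lp_contractions_PiE[of p] assms(2) by (auto simp: PiE_def)
  have ev: "eventually (\<lambda>i. T i \<in> topspace (product_topology (\<lambda>x. lp_topology p) (lp p))) F"
    using assms(3) lp_contractions_PiE[of p] by (auto elim!: eventually_mono)
  have "eventually (\<lambda>i. T i x \<in> lp p) F" if "x \<in> lp p" for x
    using assms(3) lp_contractions_PiE[of p] that by (auto elim!: eventually_mono)
  then show ?thesis using L ev
    by (auto simp: limitin_componentwise limitin_metric_dist_null)
qed

lemma limitin_lp_SOT:
  assumes "p \<ge> 1"
  shows "limitin (lp_SOT p) T L F \<longleftrightarrow>
    L \<in> lp_contractions p \<and> eventually (\<lambda>i. T i \<in> lp_contractions p) F \<and>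
    (\<forall>x\<in>lp p. ((\<lambda>i. lp_dist p (T i x) (L x)) \<longlongrightarrow> 0) F)"
  using limitin_lp_operators[OF assms] by (auto simp: lp_SOT_def limitin_subtopology)

lemma limitin_lp_SOT_star:
  assumes "p \<ge> 1"
  shows "limitin (lp_SOT_star p) T L F \<longleftrightarrow>
    L \<in> lp_contractions p \<and> eventually (\<lambda>i. T i \<in> lp_contractions p) F \<and>
    (\<forall>x\<in>lp p. ((\<lambda>i. lp_dist p (T i x) (L x)) \<longlongrightarrow> 0) F) \<and>
    (\<forall>f\<in>lp_dual p. ((\<lambda>i. lp_dual_dist p (lp_adjoint p (T i) f) (lp_adjoint p L f)) \<longlongrightarrow> 0) F)"
proof -
  interpret Metric_space "lp_dual p" "lp_dual_dist p" using Metric_space_lp_dual[OF assms] .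
  have "limitin (product_topology (\<lambda>f. lp_dual_topology p) (lp_dual p))
          (\<lambda>i. lp_adjoint p (T i)) (lp_adjoint p L) F \<longleftrightarrow>
        (\<forall>f\<in>lp_dual p. ((\<lambda>i. lp_dual_dist p (lp_adjoint p (T i) f) (lp_adjoint p L f)) \<longlongrightarrow> 0) F)"
    if L: "L \<in> lp_contractions p" and T: "eventually (\<lambda>i. T i \<in> lp_contractions p) F"
  proof -
    have 1: "lp_adjoint p L \<in> extensional (lp_dual p)" "lp_adjoint p L \<in> lp_dual p \<rightarrow> lp_dual p"
      using lp_adjoint_PiE[OF assms L] by (auto simp: PiE_def)
    have 2: "eventually (\<lambda>i. lp_adjoint p (T i) \<in> lp_dual p \<rightarrow>\<^sub>E lp_dual p) F"
      using T lp_adjoint_PiE[OF assms] by (auto elim!: eventually_mono)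
    have 3: "eventually (\<lambda>i. lp_adjoint p (T i) f \<in> lp_dual p) F" if "f \<in> lp_dual p" for f
      using 2 that by (auto elim!: eventually_mono)
    show ?thesis using 1 2 3
      by (auto simp: limitin_componentwise limitin_metric_dist_null)
  qed
  then show ?thesis
    using limitin_lp_operators[OF assms]
    by (auto simp: lp_SOT_star_def limitin_pullback_topology limitin_pairwise o_def)
qed

end

theory Submission
  imports Defs
begin

text \<open>
  By Baire's theorem for SOT it suffices that every nonempty \<open>SOT\<^sup>*\<close>-open set has nonempty
  SOT-interior. For \<open>p > 2\<close> a contraction \<open>S\<close> with \<open>\<parallel>S x\<parallel> = \<parallel>x\<parallel> = 1\<close> maps every vector with
  support disjoint from that of \<open>x\<close> to a vector vanishing on the support of \<open>S x\<close>. So if \<open>x\<close> has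
  finite support and the first \<open>N\<close> coordinates of \<open>S x\<close> are nonzero, the first \<open>N\<close> rows of \<open>S\<close>
  are determined by finitely many columns, and this is stable: columns of a nearby contraction
  control its first rows in the dual norm. Operators of (almost) this kind are \<open>SOT\<^sup>*\<close>-dense: compress
  a given contraction to finitely many coordinates, add a one-dimensional identity block to bring
  the norm up to \<open>1\<close>, and perturb slightly to make the first entries of \<open>S x\<close> nonzero.
\<close>

section \<open>Truncation and contractions on \<open>\<ell>\<^sub>p\<close>\<close>

text \<open>The obstacle is that SOT sees only columns, while
  \<open>SOT\<^sup>*\<close>-neighbourhoods also constrain rows in the dual norm. A row consists of
  finitely many entries, fixed by columns, and a tail on which SOT gives no bound in general. The
  bound comes from a trade-off: adding \<open>t\<close> times a disjoint tail vector to
  \<open>x\<close> costs at most \<open>t powr p\<close> in the p-th power of the norm, whereas a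
  nonzero entry of \<open>S x\<close> forces a gain of order \<open>t\<close> squared in that row.
  For \<open>p > 2\<close> and small \<open>t\<close> the gain would exceed the cost, even if
  \<open>lp_norm p (S x) powr p\<close> falls short of 1 by \<open>t powr p\<close>. Hence an almost
  norming vector is enough, and being almost norming survives small SOT changes, which exact
  attainment would not. Norm close to 1 is essential: an operator of smaller norm leaves room for
  tails. Scaling the compression up could move it far away; an identity block on an extra coordinate
  leaves the first \<open>N\<close> rows and columns untouched.\<close>

definition trunc :: "nat \<Rightarrow> (nat \<Rightarrow> complex) \<Rightarrow> nat \<Rightarrow> complex" where
  "trunc M x = (\<lambda>n. if n < M then x n else 0)"

definition unit_seq :: "nat \<Rightarrow> nat \<Rightarrow> complex" where
  "unit_seq n = (\<lambda>k. if k = n then 1 else 0)"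

section \<open>Monotonicity, partial sums and disjoint supports in the p-norm\<close>

lemma lp_mono:
  assumes "p \<ge> 1" "y \<in> lp p" "\<And>n. norm (x n) \<le> norm (y n)"
  shows "x \<in> lp p" "lp_norm p x \<le> lp_norm p y"
proof -
  have y: "summable (\<lambda>n. norm (y n) powr p)" using assms by (simp add: lp_def)
  have le: "norm (x n) powr p \<le> norm (y n) powr p" for n
    using assms by (intro powr_mono2) auto
  have x: "summable (\<lambda>n. norm (x n) powr p)"
    by (rule summable_comparison_test'[OF y]) (use le in auto)
  then show "x \<in> lp p" by (simp add: lp_def)
  have "(\<Sum>n. norm (x n) powr p) \<ge> 0" using x by (intro suminf_nonneg) auto
  then show "lp_norm p x \<le> lp_norm p y"
    unfolding lp_norm_def using assms(1) by (intro powr_mono2 suminf_le le x y) auto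
qed

lemma lp_norm_cong_norm:
  assumes "\<And>n. norm (x n) = norm (y n)"
  shows "lp_norm p x = lp_norm p y"
  using assms by (simp add: lp_norm_def)

lemma lp_norm_minus: "lp_norm p (\<lambda>n. x n - y n) = lp_norm p (\<lambda>n. y n - x n)"
  by (rule lp_norm_cong_norm) (simp add: norm_minus_commute)

lemma lp_diff_norm:
  assumes "p \<ge> 1" "x \<in> lp p" "y \<in> lp p"
  shows "lp_norm p (\<lambda>n. x n - y n) \<le> lp_norm p x + lp_norm p y"
  using lp_add(2)[OF assms(1,2) lp_scale(1)[OF assms(1,3), of "-1"]]
    lp_scale(2)[OF assms(1,3), of "-1"] by simp

lemma lp_diff_triangle:
  assumes "p \<ge> 1" "x \<in> lp p" "y \<in> lp p" "z \<in> lp p"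
  shows "lp_norm p (\<lambda>n. x n - z n) \<le> lp_norm p (\<lambda>n. x n - y n) + lp_norm p (\<lambda>n. y n - z n)"
  using lp_add(2)[OF assms(1) lp_diff[OF assms(1,2,3)] lp_diff[OF assms(1,3,4)]] by simp

text \<open>Membership belongs to the conclusion because the intended \<open>x\<close> is a
  coordinatewise limit not yet known to lie in \<open>lp p\<close>; bounds on finite sums pass to
  such limits.\<close>

lemma lp_norm_le_partial:
  assumes "p \<ge> 1" "c \<ge> 0" "\<And>N. (\<Sum>n<N. norm (x n) powr p) \<le> c powr p"
  shows "x \<in> lp p" "lp_norm p x \<le> c"
proof -
  have s: "summable (\<lambda>n. norm (x n) powr p)"
    by (rule summableI_nonneg_bounded) (use assms in auto)
  then show "x \<in> lp p" by (simp add: lp_def)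
  have "(\<Sum>n. norm (x n) powr p) \<le> c powr p"
    by (rule suminf_le_const[OF s]) (use assms in auto)
  moreover have "(\<Sum>n. norm (x n) powr p) \<ge> 0" using s by (intro suminf_nonneg) auto
  ultimately have "lp_norm p x \<le> (c powr p) powr (1 / p)"
    unfolding lp_norm_def using assms by (intro powr_mono2) auto
  then show "lp_norm p x \<le> c" using assms by (simp add: powr_powr)
qed

lemma partial_le_lp_norm:
  assumes "p \<ge> 1" "x \<in> lp p" "finite A"
  shows "(\<Sum>n\<in>A. norm (x n) powr p) \<le> lp_norm p x powr p"
  unfolding lp_norm_powr[OF assms(1,2)]
  by (rule sum_le_suminf) (use assms in \<open>auto simp: lp_def\<close>)

lemma lp_coord_le:
  assumes "p \<ge> 1" "x \<in> lp p"
  shows "norm (x n) \<le> lp_norm p x"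
proof -
  have "norm (x n) powr p \<le> lp_norm p x powr p"
    using partial_le_lp_norm[OF assms, of "{n}"] by simp
  then show ?thesis
    using assms(1) by (meson lp_norm_nonneg not_less norm_ge_zero powr_less_mono2 less_le_trans zero_less_one)
qed

text \<open>A disjoint vector of norm \<open>t\<close> raises the p-th power of the norm by exactly
  \<open>t powr p\<close>. The smallness of functionals on tails and the rigidity for
  \<open>p > 2\<close> both rest on comparing this cost with a lower power of
  \<open>t\<close>.\<close>

lemma lp_norm_powr_add_disjoint:
  assumes "p \<ge> 1" "x \<in> lp p" "y \<in> lp p" "\<And>n. x n = 0 \<or> y n = 0"
  shows "lp_norm p (\<lambda>n. x n + y n) powr p = lp_norm p x powr p + lp_norm p y powr p"
proof -
  have "norm (x n + y n) powr p = norm (x n) powr p + norm (y n) powr p" for n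
    using assms(4)[of n] assms(1) by auto
  then show ?thesis
    using assms lp_add(1)[OF assms(1-3)] by (simp add: lp_norm_powr suminf_add lp_def)
qed

section \<open>Truncation to finitely many coordinates\<close>

lemma trunc_lp [simp]:
  assumes "p \<ge> 1"
  shows "trunc M x \<in> lp p"
  unfolding lp_def mem_Collect_eq
  by (rule summable_finite[of "{..<M}"]) (use assms in \<open>auto simp: trunc_def\<close>)

lemma trunc_norm_le:
  assumes "p \<ge> 1" "x \<in> lp p"
  shows "lp_norm p (trunc M x) \<le> lp_norm p x" "lp_norm p (\<lambda>n. x n - trunc M x n) \<le> lp_norm p x"
  by (rule lp_mono(2)[OF assms], simp add: trunc_def)+

lemma trunc_norm_powr:
  assumes "p \<ge> 1"
  shows "lp_norm p (trunc M x) powr p = (\<Sum>n<M. norm (x n) powr p)"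
proof -
  have "(\<Sum>n. norm (trunc M x n) powr p) = (\<Sum>n<M. norm (trunc M x n) powr p)"
    by (rule suminf_finite) (use assms in \<open>auto simp: trunc_def\<close>)
  then show ?thesis using lp_norm_powr[OF assms trunc_lp[OF assms], of M x] by (simp add: trunc_def)
qed

lemma trunc_tail_tendsto:
  assumes "p \<ge> 1" "x \<in> lp p"
  shows "(\<lambda>M. lp_norm p (\<lambda>n. x n - trunc M x n)) \<longlonglongrightarrow> 0"
proof -
  have s: "summable (\<lambda>n. norm (x n) powr p)" using assms by (simp add: lp_def)
  have "lp_norm p (\<lambda>n. x n - trunc M x n) powr p = lp_norm p x powr p - (\<Sum>n<M. norm (x n) powr p)" for M
  proof -
    have eq: "(\<lambda>n. trunc M x n + (x n - trunc M x n)) = x" by auto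
    have "trunc M x n = 0 \<or> x n - trunc M x n = 0" for n by (simp add: trunc_def)
    from lp_norm_powr_add_disjoint[OF assms(1) trunc_lp lp_diff[OF assms trunc_lp], OF assms(1) assms(1) this]
    show ?thesis unfolding eq trunc_norm_powr[OF assms(1)] by simp
  qed
  moreover have "(\<lambda>M. lp_norm p x powr p - (\<Sum>n<M. norm (x n) powr p)) \<longlonglongrightarrow> 0"
    using tendsto_diff[OF tendsto_const summable_LIMSEQ[OF s], of "lp_norm p x powr p"]
      lp_norm_powr[OF assms] by simp
  ultimately have "(\<lambda>M. lp_norm p (\<lambda>n. x n - trunc M x n) powr p) \<longlonglongrightarrow> 0" by simp
  then have "(\<lambda>M. (lp_norm p (\<lambda>n. x n - trunc M x n) powr p) powr (1/p)) \<longlonglongrightarrow> 0 powr (1/p)"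
    using assms(1) by (intro tendsto_powr') auto
  then show ?thesis using assms(1) by (simp add: powr_powr)
qed

lemma unit_seq_lp [simp]: "p \<ge> 1 \<Longrightarrow> unit_seq n \<in> lp p"
  unfolding lp_def mem_Collect_eq
  by (rule summable_finite[of "{n}"]) (auto simp: unit_seq_def)

lemma lp_norm_unit_seq [simp]:
  assumes "p \<ge> 1" shows "lp_norm p (unit_seq n) = 1"
proof -
  have "(\<Sum>k. norm (unit_seq n k) powr p) = (\<Sum>k\<in>{n}. norm (unit_seq n k) powr p)"
    by (rule suminf_finite) (use assms in \<open>auto simp: unit_seq_def\<close>)
  then show ?thesis by (simp add: lp_norm_def unit_seq_def)
qed

lemma trunc_Suc: "trunc (Suc M) x = (\<lambda>n. trunc M x n + x M * unit_seq M n)"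
  by (auto simp: trunc_def unit_seq_def fun_eq_iff less_Suc_eq)

lemma trunc_0 [simp]: "trunc 0 x = (\<lambda>n. 0)"
  by (simp add: trunc_def)

lemma trunc_trunc [simp]: "trunc M (trunc K x) = trunc (min M K) x"
  by (auto simp: trunc_def)

lemma trunc_add: "trunc M (\<lambda>n. x n + y n) = (\<lambda>n. trunc M x n + trunc M y n)"
  by (auto simp: trunc_def)

lemma trunc_scale: "trunc M (\<lambda>n. c * x n) = (\<lambda>n. c * trunc M x n)"
  by (auto simp: trunc_def)

section \<open>Contractions and their control by columns\<close>

lemma lp_contractionsI:
  assumes p: "p \<ge> 1" and "T \<in> lp p \<rightarrow>\<^sub>E lp p"
    and "\<And>x y. x \<in> lp p \<Longrightarrow> y \<in> lp p \<Longrightarrow> T (\<lambda>n. x n + y n) = (\<lambda>n. T x n + T y n)"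
    and "\<And>c x. x \<in> lp p \<Longrightarrow> T (\<lambda>n. c * x n) = (\<lambda>n. c * T x n)"
    and le: "\<And>x. x \<in> lp p \<Longrightarrow> lp_norm p (T x) \<le> lp_norm p x"
  shows "T \<in> lp_contractions p"
proof -
  have "\<exists>C. \<forall>x\<in>lp p. lp_norm p (T x) \<le> C * lp_norm p x"
    using le by (intro exI[of _ 1]) auto
  then have op: "T \<in> lp_operators p" unfolding lp_operators_def using assms by blast
  have "(\<lambda>n. 0) \<in> lp_ball p" by simp
  then have "lp_ball p \<noteq> {}" by blast
  then have "lp_opnorm p T \<le> 1"
    unfolding lp_opnorm_def by (rule cSUP_least) (use le in force)
  then show ?thesis using op by (simp add: lp_contractions_def)
qed

lemma lp_contractionsD:
  assumes p: "p \<ge> 1" and T: "T \<in> lp_contractions p"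
  shows "\<And>x. x \<in> lp p \<Longrightarrow> T x \<in> lp p"
    and "\<And>x y. x \<in> lp p \<Longrightarrow> y \<in> lp p \<Longrightarrow> T (\<lambda>n. x n + y n) = (\<lambda>n. T x n + T y n)"
    and "\<And>c x. x \<in> lp p \<Longrightarrow> T (\<lambda>n. c * x n) = (\<lambda>n. c * T x n)"
    and "\<And>x. x \<in> lp p \<Longrightarrow> lp_norm p (T x) \<le> lp_norm p x"
    and "T \<in> lp_operators p"
proof -
  show op: "T \<in> lp_operators p" using T by (simp add: lp_contractions_def)
  show lp: "T x \<in> lp p" if "x \<in> lp p" for x using op that by (auto simp: lp_operators_def)
  show "T (\<lambda>n. x n + y n) = (\<lambda>n. T x n + T y n)" if "x \<in> lp p" "y \<in> lp p" for x y
    using op that by (auto simp: lp_operators_def)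
  show scale: "T (\<lambda>n. c * x n) = (\<lambda>n. c * T x n)" if "x \<in> lp p" for x c
    using op that by (auto simp: lp_operators_def)
  obtain C where C: "\<forall>x\<in>lp p. lp_norm p (T x) \<le> C * lp_norm p x"
    using op by (auto simp: lp_operators_def)
  have bdd: "bdd_above ((\<lambda>x. lp_norm p (T x)) ` lp_ball p)"
  proof (rule bdd_aboveI2)
    fix x assume x: "x \<in> lp_ball p"
    have "C * lp_norm p x \<le> \<bar>C\<bar> * 1" using x by (intro mult_mono) auto
    moreover have "lp_norm p (T x) \<le> C * lp_norm p x" using C x by blast
    ultimately show "lp_norm p (T x) \<le> \<bar>C\<bar>" by linarith
  qed
  have ball: "lp_norm p (T x) \<le> 1" if "x \<in> lp_ball p" for x
    using cSUP_upper[OF that bdd] T by (simp add: lp_contractions_def lp_opnorm_def)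
  show "lp_norm p (T x) \<le> lp_norm p x" if x: "x \<in> lp p" for x
  proof (rule field_le_epsilon)
    fix e :: real assume "e > 0"
    \<comment> \<open>Normalizing by a number slightly above the norm treats the zero vector
      together with all others.\<close>
    define r where "r = lp_norm p x + e"
    have r: "r > 0" "lp_norm p x \<le> r"
      unfolding r_def using lp_norm_nonneg[of p x] \<open>e > 0\<close> by linarith+
    have c: "norm (complex_of_real (inverse r)) = inverse r"
      using r(1) by (simp only: norm_of_real) simp
    have "inverse r * lp_norm p x \<le> inverse r * r"
      using r by (intro mult_left_mono) auto
    then have "lp_norm p (\<lambda>n. complex_of_real (inverse r) * x n) \<le> 1"
      unfolding lp_scale(2)[OF p x] c using r(1) by simp
    then have "lp_norm p (T (\<lambda>n. complex_of_real (inverse r) * x n)) \<le> 1"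
      using lp_scale(1)[OF p x] by (intro ball) blast
    then have "inverse r * lp_norm p (T x) \<le> 1"
      unfolding scale[OF x] lp_scale(2)[OF p lp[OF x]] c .
    then show "lp_norm p (T x) \<le> lp_norm p x + e"
      using r(1) unfolding r_def[symmetric] by (simp add: field_simps)
  qed
qed

lemma lp_contractions_diff:
  assumes p: "p \<ge> 1" and T: "T \<in> lp_contractions p" and x: "x \<in> lp p" "y \<in> lp p"
  shows "T (\<lambda>n. x n - y n) = (\<lambda>n. T x n - T y n)"
  using lp_contractionsD(2)[OF p T x(1) lp_scale(1)[OF p x(2), of "-1"]]
    lp_contractionsD(3)[OF p T x(2), of "-1"] by simp

lemma lp_contractions_zero:
  assumes p: "p \<ge> 1" and T: "T \<in> lp_contractions p"
  shows "T (\<lambda>n. 0) = (\<lambda>n. 0)"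
  using lp_contractionsD(3)[OF p T lp_zero, of 0] by simp

lemma lp_contractions_eqI:
  assumes "S \<in> lp_contractions p" "T \<in> lp_contractions p" "\<And>x. x \<in> lp p \<Longrightarrow> S x = T x"
  shows "S = T"
  by (rule PiE_ext[of _ "lp p" "\<lambda>_. lp p"]) (use assms lp_contractions_PiE in blast)+

text \<open>Expansion in unit vectors with the triangle inequality; each coefficient is at most
  \<open>lp_norm p x\<close>, whence the crude factor \<open>real M\<close>.\<close>

lemma contractions_diff_trunc:
  assumes p: "p \<ge> 1" and S: "S \<in> lp_contractions p" and T: "T \<in> lp_contractions p" and x: "x \<in> lp p"
    and r: "\<And>j. j < M \<Longrightarrow> lp_norm p (\<lambda>n. S (unit_seq j) n - T (unit_seq j) n) \<le> r"
  shows "lp_norm p (\<lambda>n. S (trunc M x) n - T (trunc M x) n) \<le> real M * lp_norm p x * r"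
  using r
proof (induction M)
  case 0
  then show ?case using S T p by (simp add: lp_contractions_zero)
next
  case (Suc M)
  let ?D = "\<lambda>y n. S y n - T y n"
  have D: "?D y \<in> lp p" if "y \<in> lp p" for y
    using lp_contractionsD(1)[OF p] S T that by (intro lp_diff[OF p])
  have u: "(\<lambda>n. x M * unit_seq M n) \<in> lp p" using lp_scale(1)[OF p] p by simp
  have eq: "?D (trunc (Suc M) x) = (\<lambda>n. ?D (trunc M x) n + x M * ?D (unit_seq M) n)"
    unfolding trunc_Suc
    using lp_contractionsD(2)[OF p S trunc_lp[OF p] u] lp_contractionsD(2)[OF p T trunc_lp[OF p] u]
      lp_contractionsD(3)[OF p S unit_seq_lp[OF p]] lp_contractionsD(3)[OF p T unit_seq_lp[OF p]]
    by (simp add: algebra_simps)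
  have "lp_norm p (?D (trunc (Suc M) x)) \<le> lp_norm p (?D (trunc M x)) + lp_norm p (\<lambda>n. x M * ?D (unit_seq M) n)"
    unfolding eq using p by (intro lp_add(2) D lp_scale(1)) auto
  also have "lp_norm p (\<lambda>n. x M * ?D (unit_seq M) n) = norm (x M) * lp_norm p (?D (unit_seq M))"
    using p by (intro lp_scale(2) D) auto
  also have "\<dots> \<le> lp_norm p x * r"
    using lp_coord_le[OF p x] Suc.prems[of M] by (intro mult_mono) auto
  also have "lp_norm p (?D (trunc M x)) \<le> real M * lp_norm p x * r"
    using Suc by simp
  finally show ?case by (simp add: algebra_simps)
qed

text \<open>Each contraction contributes at most the norm of the tail, which gives the factor 2. The
  tail term does not depend on \<open>S\<close> and \<open>T\<close>, so closeness on finitely many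
  columns yields closeness at \<open>x\<close> uniformly.\<close>

lemma contractions_diff_le:
  assumes p: "p \<ge> 1" and S: "S \<in> lp_contractions p" and T: "T \<in> lp_contractions p" and x: "x \<in> lp p"
  shows "lp_norm p (\<lambda>n. S x n - T x n) \<le>
    lp_norm p (\<lambda>n. S (trunc M x) n - T (trunc M x) n) + 2 * lp_norm p (\<lambda>n. x n - trunc M x n)"
proof -
  let ?y = "\<lambda>n. x n - trunc M x n"
  have y: "?y \<in> lp p" using x p by (intro lp_diff) auto
  have D: "(\<lambda>n. S y n - T y n) \<in> lp p" if "y \<in> lp p" for y
    using lp_contractionsD(1)[OF p] S T that by (intro lp_diff[OF p])
  have eq: "(\<lambda>n. S x n - T x n) = (\<lambda>n. (S (trunc M x) n - T (trunc M x) n) + (S ?y n - T ?y n))"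
    using lp_contractions_diff[OF p S x trunc_lp[OF p]] lp_contractions_diff[OF p T x trunc_lp[OF p]]
    by (simp add: algebra_simps)
  have "lp_norm p (\<lambda>n. S ?y n - T ?y n) \<le> lp_norm p (S ?y) + lp_norm p (T ?y)"
    using lp_contractionsD(1)[OF p] S T y by (intro lp_diff_norm[OF p])
  also have "\<dots> \<le> 2 * lp_norm p ?y"
    using lp_contractionsD(4)[OF p S y] lp_contractionsD(4)[OF p T y] by simp
  finally show ?thesis
    using lp_add(2)[OF p D[OF trunc_lp[OF p, of M x]] D[OF y]] unfolding eq by linarith
qed

section \<open>SOT is completely metrizable\<close>

lemma lp_complete:
  assumes p: "p \<ge> 1" and lp: "\<And>k. \<sigma> k \<in> lp p"
    and Cauchy: "\<And>e. e > 0 \<Longrightarrow> \<exists>K. \<forall>k\<ge>K. \<forall>m\<ge>K. lp_norm p (\<lambda>n. \<sigma> k n - \<sigma> m n) < e"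
  shows "\<exists>l\<in>lp p. (\<lambda>k. lp_norm p (\<lambda>n. \<sigma> k n - l n)) \<longlonglongrightarrow> 0"
proof -
  have "convergent (\<lambda>k. \<sigma> k n)" for n
    unfolding Cauchy_convergent_iff[symmetric]
  proof (rule metric_CauchyI)
    fix e :: real assume "e > 0"
    then obtain K where "\<forall>k\<ge>K. \<forall>m\<ge>K. lp_norm p (\<lambda>n. \<sigma> k n - \<sigma> m n) < e" using Cauchy by blast
    moreover have "dist (\<sigma> k n) (\<sigma> m n) \<le> lp_norm p (\<lambda>n. \<sigma> k n - \<sigma> m n)" for k m
      using lp_coord_le[OF p lp_diff[OF p lp lp], of k n m] unfolding dist_norm .
    ultimately have "\<forall>k\<ge>K. \<forall>m\<ge>K. dist (\<sigma> k n) (\<sigma> m n) < e"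
      by (meson le_less_trans)
    then show "\<exists>K. \<forall>k\<ge>K. \<forall>m\<ge>K. dist (\<sigma> k n) (\<sigma> m n) < e" by blast
  qed
  then have "\<forall>n. \<exists>z. (\<lambda>k. \<sigma> k n) \<longlonglongrightarrow> z" unfolding convergent_def by blast
  then obtain l where l: "\<And>n. (\<lambda>k. \<sigma> k n) \<longlonglongrightarrow> l n" by metis
  \<comment> \<open>The limit in \<open>m\<close> is taken in each finite partial sum, where it may
    be taken term by term; the number of summands is released only afterwards.\<close>
  have close: "(\<lambda>n. \<sigma> k n - l n) \<in> lp p \<and> lp_norm p (\<lambda>n. \<sigma> k n - l n) \<le> e"
    if e: "e > 0" and K: "\<forall>k\<ge>K. \<forall>m\<ge>K. lp_norm p (\<lambda>n. \<sigma> k n - \<sigma> m n) < e" "k \<ge> K" for e K k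
  proof -
    have "(\<Sum>n<N. norm (\<sigma> k n - l n) powr p) \<le> e powr p" for N
    proof (rule tendsto_upperbound)
      show "(\<lambda>m. \<Sum>n<N. norm (\<sigma> k n - \<sigma> m n) powr p) \<longlonglongrightarrow> (\<Sum>n<N. norm (\<sigma> k n - l n) powr p)"
        using p by (intro tendsto_sum tendsto_powr' tendsto_norm tendsto_diff tendsto_const l) auto
      show "\<forall>\<^sub>F m in sequentially. (\<Sum>n<N. norm (\<sigma> k n - \<sigma> m n) powr p) \<le> e powr p"
      proof (rule eventually_sequentiallyI[of K])
        fix m assume "m \<ge> K"
        have "(\<Sum>n<N. norm (\<sigma> k n - \<sigma> m n) powr p) \<le> lp_norm p (\<lambda>n. \<sigma> k n - \<sigma> m n) powr p"
          by (rule partial_le_lp_norm[OF p lp_diff[OF p lp lp]]) simp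
        also have "\<dots> \<le> e powr p"
          using K \<open>m \<ge> K\<close> p by (intro powr_mono2) (auto intro: less_imp_le)
        finally show "(\<Sum>n<N. norm (\<sigma> k n - \<sigma> m n) powr p) \<le> e powr p" .
      qed
    qed simp
    then show ?thesis using lp_norm_le_partial[OF p, of e "\<lambda>n. \<sigma> k n - l n"] e by simp
  qed
  obtain K where "\<forall>k\<ge>K. \<forall>m\<ge>K. lp_norm p (\<lambda>n. \<sigma> k n - \<sigma> m n) < 1" using Cauchy[of 1] by auto
  then have "(\<lambda>n. \<sigma> K n - l n) \<in> lp p" using close[of 1 K K] by simp
  from lp_diff[OF p lp[of K] this] have "l \<in> lp p" by simp
  moreover have "(\<lambda>k. lp_norm p (\<lambda>n. \<sigma> k n - l n)) \<longlonglongrightarrow> 0"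
  proof (rule LIMSEQ_I)
    fix r :: real assume "r > 0"
    then obtain K where K: "\<forall>k\<ge>K. \<forall>m\<ge>K. lp_norm p (\<lambda>n. \<sigma> k n - \<sigma> m n) < r / 2"
      using Cauchy[of "r / 2"] by auto
    have "norm (lp_norm p (\<lambda>n. \<sigma> k n - l n) - 0) < r" if "k \<ge> K" for k
      using close[OF _ K that] \<open>r > 0\<close> by simp
    then show "\<exists>K. \<forall>k\<ge>K. norm (lp_norm p (\<lambda>n. \<sigma> k n - l n) - 0) < r" by blast
  qed
  ultimately show ?thesis by blast
qed

text \<open>Columns of two contractions differ by at most 2, so weights tending to 0 make the
  supremum small as soon as finitely many columns are close. The value 0 off the carrier serves the
  global nonnegativity required by \<open>Metric_space\<close>.\<close>

definition lp_opdist ::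
    "real \<Rightarrow> ((nat \<Rightarrow> complex) \<Rightarrow> nat \<Rightarrow> complex) \<Rightarrow> ((nat \<Rightarrow> complex) \<Rightarrow> nat \<Rightarrow> complex) \<Rightarrow> real" where
  "lp_opdist p S T =
    (if S \<in> lp_contractions p \<and> T \<in> lp_contractions p
     then SUP j. lp_norm p (\<lambda>n. S (unit_seq j) n - T (unit_seq j) n) / (real j + 1) else 0)"

lemma contractions_diff_unit_le:
  assumes p: "p \<ge> 1" and S: "S \<in> lp_contractions p" and T: "T \<in> lp_contractions p"
  shows "lp_norm p (\<lambda>n. S (unit_seq j) n - T (unit_seq j) n) \<le> 2"
proof -
  have u: "unit_seq j \<in> lp p" using p by simp
  show ?thesis
    using lp_diff_norm[OF p lp_contractionsD(1)[OF p S u] lp_contractionsD(1)[OF p T u]]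
      lp_contractionsD(4)[OF p S u] lp_contractionsD(4)[OF p T u] p by simp
qed

lemma lp_opdist_upper:
  assumes p: "p \<ge> 1" and S: "S \<in> lp_contractions p" and T: "T \<in> lp_contractions p"
  shows "lp_norm p (\<lambda>n. S (unit_seq j) n - T (unit_seq j) n) \<le> (real j + 1) * lp_opdist p S T"
proof -
  have "bdd_above (range (\<lambda>j. lp_norm p (\<lambda>n. S (unit_seq j) n - T (unit_seq j) n) / (real j + 1)))"
  proof (rule bdd_aboveI2)
    fix j
    have "lp_norm p (\<lambda>n. S (unit_seq j) n - T (unit_seq j) n) / (real j + 1) \<le> 2 / 1"
      using contractions_diff_unit_le[OF assms] by (intro frac_le) auto
    then show "lp_norm p (\<lambda>n. S (unit_seq j) n - T (unit_seq j) n) / (real j + 1) \<le> 2" by simp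
  qed
  then have "lp_norm p (\<lambda>n. S (unit_seq j) n - T (unit_seq j) n) / (real j + 1) \<le> lp_opdist p S T"
    using S T cSUP_upper[of j UNIV] by (simp add: lp_opdist_def)
  then show ?thesis by (simp add: divide_le_eq mult.commute)
qed

lemma lp_opdist_least:
  assumes "S \<in> lp_contractions p" "T \<in> lp_contractions p"
    and "\<And>j. lp_norm p (\<lambda>n. S (unit_seq j) n - T (unit_seq j) n) \<le> (real j + 1) * c"
  shows "lp_opdist p S T \<le> c"
  using assms by (auto simp: lp_opdist_def divide_le_eq mult.commute intro!: cSUP_least)

lemma contractions_eq_if_unit_seq_eq:
  assumes p: "p \<ge> 1" and S: "S \<in> lp_contractions p" and T: "T \<in> lp_contractions p"
    and eq: "\<And>j. lp_norm p (\<lambda>n. S (unit_seq j) n - T (unit_seq j) n) \<le> 0"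
  shows "S = T"
proof (rule lp_contractions_eqI[OF S T])
  fix x assume x: "x \<in> lp p"
  have "lp_norm p (\<lambda>n. S x n - T x n) \<le> 2 * lp_norm p (\<lambda>n. x n - trunc M x n)" for M
    using contractions_diff_le[OF p S T x, of M] contractions_diff_trunc[OF p S T x eq, of M] by simp
  moreover have "(\<lambda>M. 2 * lp_norm p (\<lambda>n. x n - trunc M x n)) \<longlonglongrightarrow> 2 * 0"
    by (intro tendsto_mult tendsto_const trunc_tail_tendsto p x)
  ultimately have "lp_norm p (\<lambda>n. S x n - T x n) \<le> 2 * 0"
    by (intro tendsto_lowerbound[of "\<lambda>M. 2 * lp_norm p (\<lambda>n. x n - trunc M x n)" _ sequentially]) auto
  then have "lp_norm p (\<lambda>n. S x n - T x n) = 0" using lp_norm_nonneg[of p "\<lambda>n. S x n - T x n"] by linarith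
  then show "S x = T x"
    using lp_norm_eq_0[OF p lp_diff[OF p lp_contractionsD(1)[OF p S x] lp_contractionsD(1)[OF p T x]]]
    by (auto simp: fun_eq_iff)
qed

lemma Metric_space_lp_opdist:
  assumes p: "p \<ge> 1"
  shows "Metric_space (lp_contractions p) (lp_opdist p)"
proof
  show nonneg: "0 \<le> lp_opdist p S T" for S T
  proof (cases "S \<in> lp_contractions p \<and> T \<in> lp_contractions p")
    case True
    then have "lp_norm p (\<lambda>n. S (unit_seq 0) n - T (unit_seq 0) n) \<le> lp_opdist p S T"
      using lp_opdist_upper[OF p, of S T 0] by simp
    then show ?thesis by (meson lp_norm_nonneg order_trans)
  qed (auto simp: lp_opdist_def)
  show "lp_opdist p S T = lp_opdist p T S" for S T
  proof -
    have "lp_norm p (\<lambda>n. S (unit_seq j) n - T (unit_seq j) n) =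
      lp_norm p (\<lambda>n. T (unit_seq j) n - S (unit_seq j) n)" for j by (rule lp_norm_minus)
    then show ?thesis by (auto simp: lp_opdist_def)
  qed
  show "lp_opdist p S T = 0 \<longleftrightarrow> S = T"
    if ST: "S \<in> lp_contractions p" "T \<in> lp_contractions p" for S T
  proof
    assume "lp_opdist p S T = 0"
    then show "S = T"
      using lp_opdist_upper[OF p ST] by (intro contractions_eq_if_unit_seq_eq[OF p ST]) simp
  next
    assume "S = T"
    then have "lp_opdist p S T \<le> 0" using ST by (intro lp_opdist_least) auto
    then show "lp_opdist p S T = 0" using nonneg[of S T] by linarith
  qed
  show "lp_opdist p R T \<le> lp_opdist p R S + lp_opdist p S T"
    if R: "R \<in> lp_contractions p" and S: "S \<in> lp_contractions p" and T: "T \<in> lp_contractions p" for R S T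
  proof (rule lp_opdist_least[OF R T])
    fix j
    have u: "unit_seq j \<in> lp p" using p by simp
    show "lp_norm p (\<lambda>n. R (unit_seq j) n - T (unit_seq j) n)
        \<le> (real j + 1) * (lp_opdist p R S + lp_opdist p S T)"
      using lp_diff_triangle[OF p lp_contractionsD(1)[OF p R u] lp_contractionsD(1)[OF p S u]
          lp_contractionsD(1)[OF p T u]] lp_opdist_upper[OF p R S, of j] lp_opdist_upper[OF p S T, of j]
      by (simp add: distrib_left)
  qed
qed

text \<open>The bound separates two choices: \<open>M\<close>, depending on \<open>x\<close> only,
  makes the tail small; then the distance is made small against a factor that is fixed by
  \<open>M\<close>. Convergence and the Cauchy property both use it in this order.\<close>

lemma contractions_diff_le_opdist:
  assumes p: "p \<ge> 1" and S: "S \<in> lp_contractions p" and T: "T \<in> lp_contractions p" and x: "x \<in> lp p"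
  shows "lp_norm p (\<lambda>n. S x n - T x n) \<le>
    real M * lp_norm p x * ((real M + 1) * lp_opdist p S T) + 2 * lp_norm p (\<lambda>n. x n - trunc M x n)"
proof -
  have "lp_opdist p S T \<ge> 0" using Metric_space.nonneg[OF Metric_space_lp_opdist[OF p]] .
  then have "lp_norm p (\<lambda>n. S (unit_seq j) n - T (unit_seq j) n) \<le> (real M + 1) * lp_opdist p S T"
    if "j < M" for j
    using lp_opdist_upper[OF p S T, of j] that
      mult_right_mono[of "real j + 1" "real M + 1" "lp_opdist p S T"] by linarith
  from contractions_diff_trunc[OF p S T x this] contractions_diff_le[OF p S T x, of M]
  show ?thesis by fastforce
qed

lemma tendsto_opdist_pointwise:
  assumes p: "p \<ge> 1" and L: "L \<in> lp_contractions p" and T: "\<forall>\<^sub>F i in F. T i \<in> lp_contractions p"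
    and d: "((\<lambda>i. lp_opdist p (T i) L) \<longlongrightarrow> 0) F" and x: "x \<in> lp p"
  shows "((\<lambda>i. lp_norm p (\<lambda>n. T i x n - L x n)) \<longlongrightarrow> 0) F"
  unfolding tendsto_iff dist_norm
proof (intro allI impI)
  fix e :: real assume "e > 0"
  then have "\<forall>\<^sub>F M in sequentially. norm (lp_norm p (\<lambda>n. x n - trunc M x n) - 0) < e / 4"
    using trunc_tail_tendsto[OF p x] unfolding tendsto_iff dist_norm by (meson divide_pos_pos zero_less_numeral)
  then obtain M where M: "lp_norm p (\<lambda>n. x n - trunc M x n) < e / 4"
    unfolding eventually_sequentially by auto
  have "((\<lambda>i. real M * lp_norm p x * ((real M + 1) * lp_opdist p (T i) L)) \<longlongrightarrow>
      real M * lp_norm p x * ((real M + 1) * 0)) F"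
    by (intro tendsto_mult tendsto_const d)
  then have "\<forall>\<^sub>F i in F. norm (real M * lp_norm p x * ((real M + 1) * lp_opdist p (T i) L) -
      real M * lp_norm p x * ((real M + 1) * 0)) < e / 4"
    using \<open>e > 0\<close> unfolding tendsto_iff dist_norm by (meson divide_pos_pos zero_less_numeral)
  with T show "\<forall>\<^sub>F i in F. norm (lp_norm p (\<lambda>n. T i x n - L x n) - 0) < e"
  proof eventually_elim
    case (elim i)
    have "real M * lp_norm p x * ((real M + 1) * lp_opdist p (T i) L) < e / 4"
      using elim(2) by simp
    then have "lp_norm p (\<lambda>n. T i x n - L x n) < e"
      using contractions_diff_le_opdist[OF p elim(1) L x, of M] M \<open>e > 0\<close> by linarith
    then show ?case by simp
  qed
qed

lemma opdist_tendsto_if_unit_seq: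
  assumes p: "p \<ge> 1" and L: "L \<in> lp_contractions p" and T: "\<forall>\<^sub>F i in F. T i \<in> lp_contractions p"
    and d: "\<And>j. ((\<lambda>i. lp_norm p (\<lambda>n. T i (unit_seq j) n - L (unit_seq j) n)) \<longlongrightarrow> 0) F"
  shows "((\<lambda>i. lp_opdist p (T i) L) \<longlongrightarrow> 0) F"
  unfolding tendsto_iff dist_norm
proof (intro allI impI)
  fix e :: real assume "e > 0"
  \<comment> \<open>Beyond \<open>J\<close> the weight alone brings the trivial bound 2 below
    \<open>e / 2\<close>, so only the columns with index below \<open>J\<close> need
    convergence.\<close>
  obtain J :: nat where J: "2 / (e / 2) < real J" using reals_Archimedean2 by blast
  have "\<forall>\<^sub>F i in F. \<forall>j\<in>{..<J}. norm (lp_norm p (\<lambda>n. T i (unit_seq j) n - L (unit_seq j) n) - 0) < e / 2"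
    using d[unfolded tendsto_iff dist_norm, rule_format, OF half_gt_zero[OF \<open>e > 0\<close>]]
    by (intro eventually_ball_finite ballI) simp
  with T show "\<forall>\<^sub>F i in F. norm (lp_opdist p (T i) L - 0) < e"
  proof eventually_elim
    case (elim i)
    have "lp_opdist p (T i) L \<le> e / 2"
    proof (rule lp_opdist_least[OF elim(1) L])
      fix j
      show "lp_norm p (\<lambda>n. T i (unit_seq j) n - L (unit_seq j) n) \<le> (real j + 1) * (e / 2)"
      proof (cases "j < J")
        case True
        then have "lp_norm p (\<lambda>n. T i (unit_seq j) n - L (unit_seq j) n) \<le> 1 * (e / 2)"
          using elim(2) by (simp add: less_imp_le)
        also have "\<dots> \<le> (real j + 1) * (e / 2)" using \<open>e > 0\<close> by (intro mult_right_mono) auto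
        finally show ?thesis .
      next
        case False
        have "2 \<le> real J * (e / 2)" using J \<open>e > 0\<close> by (simp add: field_simps)
        also have "\<dots> \<le> (real j + 1) * (e / 2)" using False \<open>e > 0\<close> by (intro mult_right_mono) auto
        finally show ?thesis using contractions_diff_unit_le[OF p elim(1) L, of j] by linarith
      qed
    qed
    moreover have "lp_opdist p (T i) L \<ge> 0" using Metric_space.nonneg[OF Metric_space_lp_opdist[OF p]] .
    ultimately show ?case using \<open>e > 0\<close> by simp
  qed
qed

lemma contractions_pointwise_limit:
  assumes p: "p \<ge> 1" and T: "\<And>k. T k \<in> lp_contractions p"
    and L: "\<And>x. x \<in> lp p \<Longrightarrow> L x \<in> lp p \<and> (\<lambda>k. lp_norm p (\<lambda>n. T k x n - L x n)) \<longlonglongrightarrow> 0"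
    and ext: "L \<in> extensional (lp p)"
  shows "L \<in> lp_contractions p"
proof (rule lp_contractionsI[OF p])
  have lim: "(\<lambda>k. T k x n) \<longlonglongrightarrow> L x n" if x: "x \<in> lp p" for x n
  proof (rule Lim_null[THEN iffD2], rule Lim_null_comparison)
    show "\<forall>\<^sub>F k in sequentially. norm (T k x n - L x n) \<le> lp_norm p (\<lambda>n. T k x n - L x n)"
      using lp_coord_le[OF p lp_diff[OF p lp_contractionsD(1)[OF p T x]], of "L x"] L[OF x]
      by (intro always_eventually) blast
  qed (use L[OF x] in blast)
  show "L \<in> lp p \<rightarrow>\<^sub>E lp p" using L ext by (auto simp: PiE_iff)
  show "L (\<lambda>n. x n + y n) = (\<lambda>n. L x n + L y n)" if x: "x \<in> lp p" and y: "y \<in> lp p" for x y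
  proof
    fix n
    have "(\<lambda>k. T k (\<lambda>n. x n + y n) n) \<longlonglongrightarrow> L x n + L y n"
      using lp_contractionsD(2)[OF p T x y] tendsto_add[OF lim[OF x] lim[OF y]] by simp
    then show "L (\<lambda>n. x n + y n) n = L x n + L y n"
      using lim[OF lp_add(1)[OF p x y]] LIMSEQ_unique by blast
  qed
  show "L (\<lambda>n. c * x n) = (\<lambda>n. c * L x n)" if x: "x \<in> lp p" for c x
  proof
    fix n
    have "(\<lambda>k. T k (\<lambda>n. c * x n) n) \<longlonglongrightarrow> c * L x n"
      using lp_contractionsD(3)[OF p T x] tendsto_mult[OF tendsto_const lim[OF x]] by simp
    then show "L (\<lambda>n. c * x n) n = c * L x n"
      using lim[OF lp_scale(1)[OF p x]] LIMSEQ_unique by blast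
  qed
  show "lp_norm p (L x) \<le> lp_norm p x" if x: "x \<in> lp p" for x
  proof (rule tendsto_lowerbound)
    show "(\<lambda>k. lp_norm p (\<lambda>n. T k x n - L x n) + lp_norm p x) \<longlonglongrightarrow> lp_norm p x"
      using tendsto_add[OF _ tendsto_const] L[OF x] by force
    have "lp_norm p (L x) \<le> lp_norm p (\<lambda>n. T k x n - L x n) + lp_norm p x" for k
    proof -
      have "(\<lambda>n. T k x n - (T k x n - L x n)) = L x" by simp
      then show ?thesis
        using lp_diff_norm[OF p lp_contractionsD(1)[OF p T[of k] x]
            lp_diff[OF p lp_contractionsD(1)[OF p T[of k] x] conjunct1[OF L[OF x]]]]
          lp_contractionsD(4)[OF p T[of k] x] by simp
    qed
    then show "\<forall>\<^sub>F k in sequentially. lp_norm p (L x) \<le> lp_norm p (\<lambda>n. T k x n - L x n) + lp_norm p x"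
      by (intro always_eventually) blast
  qed simp
qed

lemma mcomplete_lp_opdist:
  assumes p: "p \<ge> 1"
  shows "Metric_space.mcomplete (lp_contractions p) (lp_opdist p)"
proof -
  interpret Metric_space "lp_contractions p" "lp_opdist p" by (rule Metric_space_lp_opdist[OF p])
  show ?thesis
    unfolding mcomplete_def
  proof (intro allI impI)
    fix \<sigma> assume "MCauchy \<sigma>"
    then have \<sigma>: "\<And>k. \<sigma> k \<in> lp_contractions p"
      and C: "\<And>e. e > 0 \<Longrightarrow> \<exists>K. \<forall>k m. K \<le> k \<longrightarrow> K \<le> m \<longrightarrow> lp_opdist p (\<sigma> k) (\<sigma> m) < e"
      by (auto simp: MCauchy_def)
    have "\<exists>l\<in>lp p. (\<lambda>k. lp_norm p (\<lambda>n. \<sigma> k x n - l n)) \<longlonglongrightarrow> 0" if x: "x \<in> lp p" for x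
    proof (rule lp_complete[OF p lp_contractionsD(1)[OF p \<sigma> x]])
      fix e :: real assume "e > 0"
      then have "\<forall>\<^sub>F M in sequentially. norm (lp_norm p (\<lambda>n. x n - trunc M x n) - 0) < e / 4"
        using trunc_tail_tendsto[OF p x] unfolding tendsto_iff dist_norm by (meson divide_pos_pos zero_less_numeral)
      then obtain M where M: "lp_norm p (\<lambda>n. x n - trunc M x n) < e / 4"
        unfolding eventually_sequentially by auto
      \<comment> \<open>The summand 1 keeps \<open>c\<close> positive when \<open>M\<close> is 0 or
        \<open>x\<close> is zero.\<close>
      define c where "c = real M * lp_norm p x * (real M + 1) + 1"
      have c: "c > 0" unfolding c_def by (intro add_nonneg_pos mult_nonneg_nonneg) auto
      obtain K where K: "\<And>k m. K \<le> k \<Longrightarrow> K \<le> m \<Longrightarrow> lp_opdist p (\<sigma> k) (\<sigma> m) < e / 4 / c"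
        using C[of "e / 4 / c"] \<open>e > 0\<close> c by auto
      have "lp_norm p (\<lambda>n. \<sigma> k x n - \<sigma> m x n) < e" if "K \<le> k" "K \<le> m" for k m
      proof -
        have "real M * lp_norm p x * ((real M + 1) * lp_opdist p (\<sigma> k) (\<sigma> m)) \<le> c * lp_opdist p (\<sigma> k) (\<sigma> m)"
          unfolding c_def using nonneg[of "\<sigma> k" "\<sigma> m"] by (simp add: algebra_simps)
        also have "\<dots> < e / 4" using K[OF that] c by (simp add: pos_less_divide_eq mult_ac)
        finally show ?thesis
          using contractions_diff_le_opdist[OF p \<sigma>[of k] \<sigma>[of m] x, of M] M \<open>e > 0\<close> by linarith
      qed
      then show "\<exists>K. \<forall>k\<ge>K. \<forall>m\<ge>K. lp_norm p (\<lambda>n. \<sigma> k x n - \<sigma> m x n) < e" by blast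
    qed
    then have "\<forall>x\<in>lp p. \<exists>l. l \<in> lp p \<and> (\<lambda>k. lp_norm p (\<lambda>n. \<sigma> k x n - l n)) \<longlonglongrightarrow> 0" by blast
    from bchoice[OF this] obtain L0
      where L0: "\<And>x. x \<in> lp p \<Longrightarrow> L0 x \<in> lp p \<and> (\<lambda>k. lp_norm p (\<lambda>n. \<sigma> k x n - L0 x n)) \<longlonglongrightarrow> 0"
      by blast
    define L where "L = restrict L0 (lp p)"
    have L: "L x \<in> lp p \<and> (\<lambda>k. lp_norm p (\<lambda>n. \<sigma> k x n - L x n)) \<longlonglongrightarrow> 0" if "x \<in> lp p" for x
      using L0[OF that] that by (simp add: L_def)
    have "L \<in> lp_contractions p"
      by (rule contractions_pointwise_limit[OF p \<sigma> L]) (auto simp only: L_def restrict_extensional)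
    moreover from this have "(\<lambda>k. lp_opdist p (\<sigma> k) L) \<longlonglongrightarrow> 0"
      using \<sigma> L p by (intro opdist_tendsto_if_unit_seq[OF p]) auto
    ultimately show "\<exists>L. limitin mtopology \<sigma> L sequentially"
      using \<sigma> by (auto simp: limitin_metric_dist_null)
  qed
qed

lemma topology_eq_if_limitin_iff:
  assumes top: "topspace X = topspace Y"
    and lim: "\<And>l F. limitin X (\<lambda>x. x) l F \<longleftrightarrow> limitin Y (\<lambda>x. x) l F"
  shows "X = Y"
proof -
  have self: "limitin Z (\<lambda>x. x) x (atin Z x)" if "x \<in> topspace Z" for Z :: "'a topology" and x
    using that continuous_map_id[of Z] unfolding continuous_map_atin by (auto simp: id_def)
  have "continuous_map Y X id" "continuous_map X Y id"
    unfolding continuous_map_atin id_def using self lim top by blast+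
  then show ?thesis
    using topology_finer_continuous_id[OF top] topology_finer_continuous_id[OF top[symmetric]]
    unfolding topology_eq by blast
qed

lemma lp_SOT_eq_mtopology:
  assumes p: "p \<ge> 1"
  shows "lp_SOT p = Metric_space.mtopology (lp_contractions p) (lp_opdist p)"
proof -
  interpret Metric_space "lp_contractions p" "lp_opdist p" by (rule Metric_space_lp_opdist[OF p])
  show ?thesis
  proof (rule topology_eq_if_limitin_iff)
    show "topspace (lp_SOT p) = topspace mtopology" by (simp add: topspace_lp_SOT[OF p])
    show "limitin (lp_SOT p) (\<lambda>x. x) L F \<longleftrightarrow> limitin mtopology (\<lambda>x. x) L F" for L F
      unfolding limitin_lp_SOT[OF p] limitin_metric_dist_null lp_dist_def
      using opdist_tendsto_if_unit_seq[OF p, of L "\<lambda>x. x" F] tendsto_opdist_pointwise[OF p, of L "\<lambda>x. x" F]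
        unit_seq_lp[OF p] by blast
  qed
qed

lemma completely_metrizable_space_lp_SOT:
  assumes "p \<ge> 1"
  shows "completely_metrizable_space (lp_SOT p)"
  unfolding lp_SOT_eq_mtopology[OF assms]
  by (rule Metric_space.completely_metrizable_space_mtopology[OF Metric_space_lp_opdist mcomplete_lp_opdist])
    (use assms in auto)

lemma openin_lp_SOT_star_if_openin_lp_SOT:
  assumes p: "p \<ge> 1" and U: "openin (lp_SOT p) U"
  shows "openin (lp_SOT_star p) U"
proof -
  have top: "topspace (lp_SOT_star p) = topspace (lp_SOT p)"
    by (simp add: topspace_lp_SOT[OF p] topspace_lp_SOT_star[OF p])
  have self: "limitin (lp_SOT_star p) (\<lambda>x. x) T (atin (lp_SOT_star p) T)"
    if "T \<in> topspace (lp_SOT_star p)" for T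
    using that continuous_map_id[of "lp_SOT_star p"] unfolding continuous_map_atin by (auto simp: id_def)
  have "continuous_map (lp_SOT_star p) (lp_SOT p) id"
    unfolding continuous_map_atin id_def
  proof
    fix T assume "T \<in> topspace (lp_SOT_star p)"
    from self[OF this] show "limitin (lp_SOT p) (\<lambda>x. x) T (atin (lp_SOT_star p) T)"
      unfolding limitin_lp_SOT[OF p] limitin_lp_SOT_star[OF p] by blast
  qed
  then show ?thesis using topology_finer_continuous_id[OF top[symmetric]] U by blast
qed

section \<open>Functionals on tails and \<open>SOT\<^sup>*\<close>-neighbourhoods\<close>

lemma powr_le_imp_le:
  fixes a b p :: real
  assumes "p > 0" "b \<ge> 0" "a powr p \<le> b powr p"
  shows "a \<le> b"
  using powr_less_mono2[of p b a] assms by linarith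

lemma lp_dual_le_of_ball:
  assumes p: "p \<ge> 1" and f: "f \<in> lp_dual p" and D: "\<And>x. x \<in> lp_ball p \<Longrightarrow> norm (f x) \<le> D"
    and z: "z \<in> lp p" "lp_norm p z \<le> R" and R: "R > 0"
  shows "norm (f z) \<le> D * R"
proof -
  have c: "norm (complex_of_real (inverse R)) = inverse R"
    using R by (simp only: norm_of_real) simp
  have "inverse R * lp_norm p z \<le> inverse R * R"
    using z R by (intro mult_left_mono) auto
  then have "lp_norm p (\<lambda>n. complex_of_real (inverse R) * z n) \<le> 1"
    unfolding lp_scale(2)[OF p z(1)] c using R by simp
  then have "norm (f (\<lambda>n. complex_of_real (inverse R) * z n)) \<le> D"
    using lp_scale(1)[OF p z(1)] by (intro D) blast
  moreover have "f (\<lambda>n. complex_of_real (inverse R) * z n) = complex_of_real (inverse R) * f z"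
    using f z by (simp add: lp_dual_def)
  ultimately have "inverse R * norm (f z) \<le> D" by (simp only: norm_mult c)
  then show ?thesis using R by (simp add: field_simps)
qed

text \<open>A tail vector orthogonal to an almost norming vector of \<open>f\<close> increases the \<open>\<ell>\<^sub>p\<close>-norm only to
  order \<open>t powr p\<close>, so \<open>f\<close> must be small on it; this avoids representing the dual by sequences.\<close>

lemma lp_dual_tail_small:
  assumes p: "p > 1" and f: "f \<in> lp_dual p" and e: "e > 0"
  shows "\<exists>M. \<forall>u\<in>lp_ball p. (\<forall>n<M. u n = 0) \<longrightarrow> norm (f u) \<le> e"
proof -
  have p1: "p \<ge> 1" using p by simp
  have fadd: "f (\<lambda>n. x n + y n) = f x + f y" if "x \<in> lp p" "y \<in> lp p" for x y
    using f that by (simp add: lp_dual_def)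
  have fscale: "f (\<lambda>n. c * x n) = c * f x" if "x \<in> lp p" for x c
    using f that by (simp add: lp_dual_def)
  obtain C0 where C0: "\<forall>x\<in>lp p. norm (f x) \<le> C0 * lp_norm p x" using f by (auto simp: lp_dual_def)
  define C where "C = \<bar>C0\<bar> + 1"
  have C: "C > 0" "norm (f x) \<le> C * lp_norm p x" if "x \<in> lp p" for x
  proof -
    show "C > 0" unfolding C_def by linarith
    have "C0 * lp_norm p x \<le> C * lp_norm p x" unfolding C_def by (intro mult_right_mono) auto
    then show "norm (f x) \<le> C * lp_norm p x" using C0 that by fastforce
  qed
  have Cpos: "C > 0" using C(1) lp_zero by blast
  have ballC: "norm (f x) \<le> C" if "x \<in> lp_ball p" for x
  proof -
    have "norm (f x) \<le> C * lp_norm p x" using C that by simp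
    also have "\<dots> \<le> C * 1" using that Cpos by (intro mult_left_mono) auto
    finally show ?thesis by simp
  qed
  have ne: "lp_ball p \<noteq> {}" using lp_zero by fastforce
  have bdd: "bdd_above ((\<lambda>x. norm (f x)) ` lp_ball p)" using ballC by (rule bdd_aboveI2)
  define D where "D = (SUP x\<in>lp_ball p. norm (f x))"
  have D: "norm (f x) \<le> D" if "x \<in> lp_ball p" for x
    unfolding D_def by (rule cSUP_upper[OF that bdd])
  have D0: "D \<ge> 0" using order_trans[OF norm_ge_zero D[of "\<lambda>n. 0"]] by simp
  \<comment> \<open>Solves \<open>t powr (p - 1) = e / 2 / (D + 1)\<close>, so that the cost
    \<open>D * t powr p\<close> is at most half of \<open>t * e\<close>; \<open>D + 1\<close> covers
    the case \<open>D = 0\<close>.\<close>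
  define t where "t = (e / 2 / (D + 1)) powr (1 / (p - 1))"
  have t: "t > 0" using e D0 unfolding t_def by simp
  have tp: "D * t powr p \<le> t * (e / 2)"
  proof -
    have "t powr (p - 1) = e / 2 / (D + 1)"
      unfolding t_def using p e D0 by (simp add: powr_powr)
    then have "D * t powr (p - 1) = (D / (D + 1)) * (e / 2)" by simp
    also have "\<dots> \<le> 1 * (e / 2)" using D0 e by (intro mult_right_mono) auto
    finally have "t * (D * t powr (p - 1)) \<le> t * (e / 2)" using t by (intro mult_left_mono) auto
    moreover have "t powr p = t * t powr (p - 1)"
      using t by (simp add: powr_mult_base)
    ultimately show ?thesis by (simp add: mult_ac)
  qed
  \<comment> \<open>The allowed loss \<open>t * e / 2\<close> is shared equally between
    \<open>x\<close> being only an almost maximizer and its truncation.\<close>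
  have "D - t * e / 4 < D" using t e by simp
  then obtain x where x: "x \<in> lp_ball p" "norm (f x) > D - t * e / 4"
    unfolding D_def using less_cSUP_iff[OF ne bdd] by auto
  have "t * e / 4 / C > 0" using t e Cpos by simp
  then have "\<forall>\<^sub>F M in sequentially. norm (lp_norm p (\<lambda>n. x n - trunc M x n) - 0) < t * e / 4 / C"
    using trunc_tail_tendsto[OF p1, of x] x unfolding tendsto_iff dist_norm by blast
  then obtain M where M: "lp_norm p (\<lambda>n. x n - trunc M x n) < t * e / 4 / C"
    unfolding eventually_sequentially by auto
  have y: "trunc M x \<in> lp p" "lp_norm p (trunc M x) \<le> 1"
    using trunc_norm_le(1)[OF p1, of x M] x p1 by auto
  have fy: "norm (f (trunc M x)) > D - t * e / 2"
  proof -
    have d: "(\<lambda>n. x n - trunc M x n) \<in> lp p" using x y p1 by (intro lp_diff) auto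
    have "norm (f (\<lambda>n. x n - trunc M x n)) \<le> C * lp_norm p (\<lambda>n. x n - trunc M x n)" using C(2)[OF d] .
    also have "\<dots> < t * e / 4" using M Cpos by (simp add: pos_less_divide_eq mult_ac)
    moreover have "norm (f x) \<le> norm (f (trunc M x)) + norm (f (\<lambda>n. x n - trunc M x n))"
      using fadd[OF y(1) d] norm_triangle_ineq[of "f (trunc M x)"] by simp
    ultimately show ?thesis using x(2) by linarith
  qed
  have "norm (f u) \<le> e" if u: "u \<in> lp_ball p" "\<forall>n<M. u n = 0" for u
  proof -
    \<comment> \<open>A unimodular factor giving \<open>c * f u\<close> the phase of
      \<open>f (trunc M x)\<close>, so that the two moduli add; the default 1 keeps it unimodular
      when one of the values vanishes.\<close>
    define c where "c = (if f u = 0 \<or> f (trunc M x) = 0 then 1 else sgn (f (trunc M x)) / sgn (f u))"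
    have nc: "norm c = 1" by (auto simp: c_def norm_divide norm_sgn)
    let ?v = "\<lambda>n. complex_of_real t * c * u n"
    have v: "?v \<in> lp p" "lp_norm p ?v = t * lp_norm p u"
      using lp_scale[OF p1, of u "complex_of_real t * c"] u t nc by (auto simp: norm_mult)
    let ?z = "\<lambda>n. trunc M x n + ?v n"
    have "lp_norm p ?z powr p = lp_norm p (trunc M x) powr p + (t * lp_norm p u) powr p"
      unfolding v(2)[symmetric]
      by (rule lp_norm_powr_add_disjoint[OF p1 y(1) v(1)]) (use u in \<open>auto simp: trunc_def\<close>)
    also have "\<dots> \<le> 1 powr p + (t * 1) powr p"
      using y u t p by (intro add_mono powr_mono2 mult_left_mono) auto
    also have "\<dots> \<le> (1 + t powr p) powr p"
      using powr_mono[of 1 p "1 + t powr p"] p by simp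
    finally have z: "lp_norm p ?z \<le> 1 + t powr p"
      by (rule powr_le_imp_le[rotated 2]) (use p in auto)
    have "norm (f ?z) \<le> D * (1 + t powr p)"
    proof (rule lp_dual_le_of_ball[OF p1 f D _ z])
      show "?z \<in> lp p" by (rule lp_add(1)[OF p1 y(1) v(1)])
      show "1 + t powr p > 0" by (simp add: add_pos_nonneg)
    qed
    moreover have "f ?z = f (trunc M x) + complex_of_real t * (c * f u)"
      using fadd[OF y(1) v(1)] fscale[of u "complex_of_real t * c"] u by (simp add: mult.assoc)
    moreover have "norm (f (trunc M x) + complex_of_real t * (c * f u)) = norm (f (trunc M x)) + t * norm (f u)"
    proof (cases "f u = 0 \<or> f (trunc M x) = 0")
      case True
      then show ?thesis using t nc by (auto simp: norm_mult)
    next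
      case False
      then have "c * f u = sgn (f (trunc M x)) * norm (f u)"
        by (simp add: c_def sgn_eq field_simps)
      moreover have "f (trunc M x) = sgn (f (trunc M x)) * norm (f (trunc M x))"
        by (simp add: sgn_eq)
      ultimately have "f (trunc M x) + complex_of_real t * (c * f u) =
          sgn (f (trunc M x)) * complex_of_real (norm (f (trunc M x)) + t * norm (f u))"
        by (simp add: algebra_simps)
      moreover have "norm (sgn (f (trunc M x))) = 1" using False by (simp add: norm_sgn)
      moreover have "norm (f (trunc M x)) + t * norm (f u) \<ge> 0" using t by simp
      ultimately show ?thesis by (simp only: norm_mult norm_of_real abs_of_nonneg mult_1)
    qed
    ultimately have "D - t * e / 2 + t * norm (f u) \<le> D * (1 + t powr p)" using fy by simp
    then have "t * norm (f u) \<le> t * e" using tp by (simp add: distrib_left mult.commute)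
    then show ?thesis using t by simp
  qed
  then show ?thesis by blast
qed

section \<open>Convergence of adjoints tested on rows\<close>

lemma lp_dual_trunc:
  assumes p: "p \<ge> 1" and f: "f \<in> lp_dual p"
  shows "f (trunc M y) = (\<Sum>i<M. y i * f (unit_seq i))"
proof (induction M)
  case 0
  have "\<forall>c. \<forall>x\<in>lp p. f (\<lambda>n. c * x n) = c * f x" using f unfolding lp_dual_def by blast
  from this[rule_format, OF lp_zero, of 0] show ?case by simp
next
  case (Suc M)
  have u: "unit_seq M \<in> lp p" using p by simp
  have "f (trunc (Suc M) y) = f (trunc M y) + f (\<lambda>n. y M * unit_seq M n)"
    unfolding trunc_Suc using f trunc_lp[OF p] lp_scale(1)[OF p u] by (simp add: lp_dual_def)
  then show ?case using Suc f u by (simp add: lp_dual_def)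
qed

lemma lp_adjoint_apply:
  "f \<in> lp_dual p \<Longrightarrow> x \<in> lp p \<Longrightarrow> lp_adjoint p T f x = f (T x)"
  by (simp add: lp_adjoint_def)

text \<open>Contractions map the unit ball into itself, so the part of \<open>f\<close> beyond some
  \<open>M\<close> contributes a small error uniformly in \<open>k\<close>. What remains is a finite
  combination of the first \<open>M\<close> rows, whose convergence is the hypothesis
  \<open>rows\<close>.\<close>

lemma adjoint_tendsto_if_coords:
  assumes p: "p > 1" and T: "\<And>k. T k \<in> lp_contractions p" and L: "L \<in> lp_contractions p"
    and rows: "\<And>i e. e > 0 \<Longrightarrow> \<forall>\<^sub>F k in F. \<forall>u\<in>lp_ball p. norm (T k u i - L u i) \<le> e"
    and f: "f \<in> lp_dual p"
  shows "((\<lambda>k. lp_dual_dist p (lp_adjoint p (T k) f) (lp_adjoint p L f)) \<longlongrightarrow> 0) F"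
  unfolding tendsto_iff dist_norm
proof (intro allI impI)
  fix e :: real assume e: "e > 0"
  have p1: "p \<ge> 1" using p by simp
  obtain M where M: "\<And>u. u \<in> lp_ball p \<Longrightarrow> \<forall>n<M. u n = 0 \<Longrightarrow> norm (f u) \<le> e / 8"
    using lp_dual_tail_small[OF p f, of "e / 8"] e by auto
  \<comment> \<open>The summand 1 allows division by \<open>B\<close> even if \<open>f\<close>
    vanishes on the first \<open>M\<close> unit vectors.\<close>
  define B where "B = (\<Sum>i<M. norm (f (unit_seq i))) + 1"
  have B: "B > 0" unfolding B_def by (intro add_nonneg_pos sum_nonneg) auto
  have "e / 4 / B > 0" using e B by simp
  then have "\<forall>\<^sub>F k in F. \<forall>i\<in>{..<M}. \<forall>u\<in>lp_ball p. norm (T k u i - L u i) \<le> e / 4 / B"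
    by (intro eventually_ball_finite ballI rows) simp_all
  then show "\<forall>\<^sub>F k in F. norm (lp_dual_dist p (lp_adjoint p (T k) f) (lp_adjoint p L f) - 0) < e"
  proof eventually_elim
    case (elim k)
    have fdiff: "f (\<lambda>n. x n - y n) = f x - f y" if x: "x \<in> lp p" and y: "y \<in> lp p" for x y
    proof -
      have add: "\<forall>x\<in>lp p. \<forall>y\<in>lp p. f (\<lambda>n. x n + y n) = f x + f y"
        using f unfolding lp_dual_def by blast
      have "f (\<lambda>n. x n + (-1) * y n) = f x + f (\<lambda>n. (-1) * y n)"
        by (rule add[rule_format, OF x lp_scale(1)[OF p1 y, of "-1"]])
      also have "f (\<lambda>n. (-1) * y n) = (-1) * f y" using f y unfolding lp_dual_def by blast
      finally show ?thesis by simp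
    qed
    have tail: "norm (f (\<lambda>n. S u n - trunc M (S u) n)) \<le> e / 8"
      if S: "S \<in> lp_contractions p" and u: "u \<in> lp_ball p" for S u
    proof (rule M)
      have Su: "S u \<in> lp p" "lp_norm p (S u) \<le> 1"
        using lp_contractionsD(1,4)[OF p1 S, of u] u by auto
      then show "(\<lambda>n. S u n - trunc M (S u) n) \<in> lp_ball p"
        using trunc_norm_le(2)[OF p1 Su(1), of M] lp_diff[OF p1 Su(1) trunc_lp[OF p1]] by auto
    qed (simp add: trunc_def)
    have split: "f (S u) = (\<Sum>i<M. S u i * f (unit_seq i)) + f (\<lambda>n. S u n - trunc M (S u) n)"
      if S: "S \<in> lp_contractions p" and u: "u \<in> lp_ball p" for S u
      using fdiff[OF lp_contractionsD(1)[OF p1 S] trunc_lp[OF p1], of u M "S u"] u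
        lp_dual_trunc[OF p1 f, of M "S u"] by simp
    have "lp_dual_dist p (lp_adjoint p (T k) f) (lp_adjoint p L f) \<le> e / 2"
    proof (rule lp_dual_dist_least)
      show "lp_adjoint p (T k) f \<in> lp_dual p" "lp_adjoint p L f \<in> lp_dual p"
        using lp_adjoint_in_dual[OF p1 _ f] lp_contractionsD(5)[OF p1] T L by blast+
      fix u assume u: "u \<in> lp_ball p"
      have "norm ((\<Sum>i<M. T k u i * f (unit_seq i)) - (\<Sum>i<M. L u i * f (unit_seq i))) \<le>
          (\<Sum>i<M. e / 4 / B * norm (f (unit_seq i)))"
        unfolding sum_subtractf[symmetric] left_diff_distrib[symmetric]
        by (intro sum_norm_le, unfold norm_mult, intro mult_right_mono) (use elim u in blast, simp)
      also have "\<dots> = e / 4 / B * (B - 1)" by (simp add: B_def sum_distrib_left)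
      also have "\<dots> \<le> e / 4 / B * B" using e B by (intro mult_left_mono) auto
      finally have 1: "norm ((\<Sum>i<M. T k u i * f (unit_seq i)) - (\<Sum>i<M. L u i * f (unit_seq i))) \<le> e / 4"
        using B by simp
      have 2: "norm (f (\<lambda>n. T k u n - trunc M (T k u) n) - f (\<lambda>n. L u n - trunc M (L u) n)) \<le> e / 4"
        using norm_triangle_ineq4[of "f (\<lambda>n. T k u n - trunc M (T k u) n)" "f (\<lambda>n. L u n - trunc M (L u) n)"]
          tail[OF T[of k] u] tail[OF L u] by linarith
      have "norm (f (T k u) - f (L u)) \<le> e / 4 + e / 4"
        unfolding split[OF T[of k] u] split[OF L u] add_diff_add
        by (rule order_trans[OF norm_triangle_ineq add_mono[OF 1 2]])
      then show "norm (lp_adjoint p (T k) f u - lp_adjoint p L f u) \<le> e / 2"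
        using u lp_adjoint_apply[OF f] by simp
    qed
    moreover have "lp_dual_dist p (lp_adjoint p (T k) f) (lp_adjoint p L f) \<ge> 0"
      using Metric_space.nonneg[OF Metric_space_lp_dual[OF p1]] .
    ultimately show ?case using e by simp
  qed
qed

text \<open>Otherwise there are counterexamples \<open>S N\<close> for every \<open>N\<close>, each
  column and each row of which converges to that of \<open>T\<close>. By uniform boundedness they
  converge to \<open>T\<close> in \<open>SOT\<^sup>*\<close> while avoiding its neighbourhood
  \<open>V\<close>. One number \<open>N\<close> serves as the count of columns and rows and as the
  accuracy.\<close>

lemma SOT_star_neighbourhood:
  assumes p: "p > 1" and V: "openin (lp_SOT_star p) V" and T: "T \<in> V"
  shows "\<exists>N. \<forall>S\<in>lp_contractions p.
    (\<forall>j<N. lp_norm p (\<lambda>n. S (unit_seq j) n - T (unit_seq j) n) \<le> 1 / (real N + 1) \<and>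
      (\<forall>u\<in>lp_ball p. norm (S u j - T u j) \<le> 1 / (real N + 1))) \<longrightarrow> S \<in> V"
proof (rule ccontr)
  have p1: "p \<ge> 1" using p by simp
  let ?P = "\<lambda>N S. S \<in> lp_contractions p \<and> S \<notin> V \<and>
    (\<forall>j<N. lp_norm p (\<lambda>n. S (unit_seq j) n - T (unit_seq j) n) \<le> 1 / (real N + 1) \<and>
      (\<forall>u\<in>lp_ball p. norm (S u j - T u j) \<le> 1 / (real N + 1)))"
  assume "\<not> ?thesis"
  then have "\<forall>N. \<exists>S. ?P N S" by blast
  then obtain S where "\<forall>N. ?P N (S N)" by (rule choice[THEN exE])
  then have S: "\<And>N. S N \<in> lp_contractions p" "\<And>N. S N \<notin> V"
    and col: "\<And>N j. j < N \<Longrightarrow> lp_norm p (\<lambda>n. S N (unit_seq j) n - T (unit_seq j) n) \<le> 1 / (real N + 1)"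
    and row: "\<And>N j u. j < N \<Longrightarrow> u \<in> lp_ball p \<Longrightarrow> norm (S N u j - T u j) \<le> 1 / (real N + 1)"
    by blast+
  have Tc: "T \<in> lp_contractions p"
    using openin_subset[OF V] T topspace_lp_SOT_star[OF p1] by auto
  have lim: "(\<lambda>N. 1 / (real N + 1)) \<longlonglongrightarrow> 0"
    using LIMSEQ_inverse_real_of_nat by (simp add: inverse_eq_divide add.commute)
  have "(\<lambda>N. lp_norm p (\<lambda>n. S N (unit_seq j) n - T (unit_seq j) n)) \<longlonglongrightarrow> 0" for j
  proof (rule Lim_null_comparison[OF _ lim], rule eventually_sequentiallyI[of "Suc j"])
    show "norm (lp_norm p (\<lambda>n. S N (unit_seq j) n - T (unit_seq j) n)) \<le> 1 / (real N + 1)"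
      if "Suc j \<le> N" for N using col[of j N] that by simp
  qed
  then have "(\<lambda>N. lp_opdist p (S N) T) \<longlonglongrightarrow> 0"
    using S(1) by (intro opdist_tendsto_if_unit_seq[OF p1 Tc]) auto
  then have SOT: "(\<lambda>N. lp_norm p (\<lambda>n. S N x n - T x n)) \<longlonglongrightarrow> 0" if "x \<in> lp p" for x
    using S(1) that by (intro tendsto_opdist_pointwise[OF p1 Tc]) auto
  have rows: "\<forall>\<^sub>F N in sequentially. \<forall>u\<in>lp_ball p. norm (S N u i - T u i) \<le> e" if "e > 0" for i e
  proof -
    have "\<forall>\<^sub>F N in sequentially. dist (1 / (real N + 1)) 0 < e"
      using lim that unfolding tendsto_iff by blast
    with eventually_gt_at_top[of i] show ?thesis
    proof eventually_elim
      case (elim N)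
      show ?case
      proof
        fix u assume "u \<in> lp_ball p"
        from row[OF elim(1) this] elim(2) show "norm (S N u i - T u i) \<le> e" by simp
      qed
    qed
  qed
  have "limitin (lp_SOT_star p) S T sequentially"
    unfolding limitin_lp_SOT_star[OF p1] lp_dist_def
    using Tc S(1) SOT adjoint_tendsto_if_coords[OF p S(1) Tc rows] by auto
  then have "\<forall>\<^sub>F N in sequentially. S N \<in> V" using V T by (auto simp: limitin_def)
  then show False using S(2) by (auto simp: eventually_sequentially)
qed

section \<open>Rigidity of contractions for \<open>p > 2\<close>\<close>

text \<open>The parallelogram law writes the sum \<open>A + B\<close> of the squared moduli as the
  mean of those of \<open>a + b\<close> and \<open>a - b\<close>; convexity of the power
  \<open>q = p / 2\<close> and \<open>(A + B) powr q \<ge> A powr q + A powr (q - 1) * B\<close> do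
  the rest. For \<open>a = 0\<close> the left side is 0, since \<open>0 powr r = 0\<close> also for
  \<open>r = 0\<close>.\<close>

lemma cmod_parallelogram_powr:
  fixes a b :: complex
  assumes p: "p \<ge> 2"
  shows "2 * (norm a powr p + norm a powr (p - 2) * (norm b)\<^sup>2) \<le> norm (a + b) powr p + norm (a - b) powr p"
proof (cases "a = 0")
  case False
  define q where "q = p / 2"
  have q: "q \<ge> 1" "p = 2 * q" using p by (auto simp: q_def)
  have sq: "((norm z)\<^sup>2) powr r = norm z powr (2 * r)" for z :: complex and r
    by (simp add: powr_powr flip: powr_numeral)
  define A B where "A = (norm a)\<^sup>2" and "B = (norm b)\<^sup>2"
  have AB: "A > 0" "B \<ge> 0" using False by (auto simp: A_def B_def)
  have par: "(1/2) * (norm (a + b))\<^sup>2 + (1/2) * (norm (a - b))\<^sup>2 = A + B"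
    unfolding A_def B_def cmod_power2 by (simp add: power2_eq_square algebra_simps)
  have "A powr q + A powr (q - 1) * B = (A + B) * A powr (q - 1)"
    using powr_mult_base[of A "q - 1"] AB by (simp add: algebra_simps)
  also have "\<dots> \<le> (A + B) * (A + B) powr (q - 1)"
    using AB q by (intro mult_left_mono powr_mono2) auto
  also have "\<dots> = (A + B) powr q" using powr_mult_base[of "A + B" "q - 1"] AB by simp
  also have "\<dots> \<le> (1/2) * ((norm (a + b))\<^sup>2) powr q + (1/2) * ((norm (a - b))\<^sup>2) powr q"
    unfolding par[symmetric] using q by (intro powr_convex_nonneg) auto
  finally show ?thesis
    unfolding sq A_def B_def using q(2) by (simp add: algebra_simps)
qed simp

text \<open>If \<open>S x\<close> has almost full norm, then, because \<open>p > 2\<close>, the second order gain at a coordinate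
  in the support of \<open>S x\<close> cannot be paid for by the \<open>t powr p\<close> that a disjoint \<open>u\<close> adds to the norm.\<close>

lemma contraction_disjoint_gain:
  assumes p: "p > 2" and S: "S \<in> lp_contractions p"
    and x: "x \<in> lp_ball p" and u: "u \<in> lp_ball p" and disj: "\<And>n. x n = 0 \<or> u n = 0" and t: "t \<ge> 0"
  shows "norm (S x i) powr (p - 2) * (t\<^sup>2 * (norm (S u i))\<^sup>2) \<le> 1 + t powr p - lp_norm p (S x) powr p"
proof -
  have p1: "p \<ge> 1" using p by simp
  have xl: "x \<in> lp p" "lp_norm p x \<le> 1" and ul: "u \<in> lp p" "lp_norm p u \<le> 1" using x u by auto
  \<comment> \<open>Stated for every phase of \<open>c\<close>, since it is applied to both
    \<open>t\<close> and \<open>-t\<close>.\<close>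
  have bound: "lp_norm p (\<lambda>n. S x n + c * S u n) powr p \<le> 1 + t powr p" if c: "norm c = t" for c
  proof -
    have cu: "(\<lambda>n. c * u n) \<in> lp p" "lp_norm p (\<lambda>n. c * u n) = t * lp_norm p u"
      using lp_scale[OF p1 ul(1), of c] c by auto
    have "S (\<lambda>n. x n + c * u n) = (\<lambda>n. S x n + c * S u n)"
      using lp_contractionsD(2)[OF p1 S xl(1) cu(1)] lp_contractionsD(3)[OF p1 S ul(1), of c] by simp
    then have "lp_norm p (\<lambda>n. S x n + c * S u n) powr p \<le> lp_norm p (\<lambda>n. x n + c * u n) powr p"
      using lp_contractionsD(4)[OF p1 S lp_add(1)[OF p1 xl(1) cu(1)]] p by (intro powr_mono2) auto
    also have "\<dots> = lp_norm p x powr p + (t * lp_norm p u) powr p"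
      unfolding cu(2)[symmetric]
      by (rule lp_norm_powr_add_disjoint[OF p1 xl(1) cu(1)]) (use disj in auto)
    also have "\<dots> \<le> 1 powr p + (t * 1) powr p"
      using xl ul t p by (intro add_mono powr_mono2 mult_left_mono) auto
    finally show ?thesis by simp
  qed
  let ?a = "S x" and ?b = "\<lambda>n. complex_of_real t * S u n"
  have a: "?a \<in> lp p" and b: "?b \<in> lp p"
    using lp_contractionsD(1)[OF p1 S] xl(1) ul(1) lp_scale(1)[OF p1] by auto
  have ab: "(\<lambda>n. ?a n + ?b n) \<in> lp p" "(\<lambda>n. ?a n - ?b n) \<in> lp p"
    using lp_add(1)[OF p1 a b] lp_diff[OF p1 a b] by auto
  \<comment> \<open>The second difference of the p-th powers, coordinate by coordinate. All its
    terms are nonnegative, so its sum dominates the single term at \<open>i\<close>.\<close>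
  let ?g = "\<lambda>n. norm (?a n + ?b n) powr p + norm (?a n - ?b n) powr p - 2 * norm (?a n) powr p"
  have sa: "(\<lambda>n. norm (?a n) powr p) sums (lp_norm p ?a powr p)"
    using a lp_norm_powr[OF p1 a] by (simp add: lp_def summable_sums)
  have sp: "(\<lambda>n. norm (?a n + ?b n) powr p) sums (lp_norm p (\<lambda>n. ?a n + ?b n) powr p)"
    using ab(1) lp_norm_powr[OF p1 ab(1)] by (simp add: lp_def summable_sums)
  have sm: "(\<lambda>n. norm (?a n - ?b n) powr p) sums (lp_norm p (\<lambda>n. ?a n - ?b n) powr p)"
    using ab(2) lp_norm_powr[OF p1 ab(2)] by (simp add: lp_def summable_sums)
  have g: "?g sums (lp_norm p (\<lambda>n. ?a n + ?b n) powr p + lp_norm p (\<lambda>n. ?a n - ?b n) powr p - 2 * lp_norm p ?a powr p)"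
    by (intro sums_diff sums_add sums_mult sa sp sm)
  have gn: "2 * (norm (?a n) powr (p - 2) * (norm (?b n))\<^sup>2) \<le> ?g n" for n
    using cmod_parallelogram_powr[of p "?a n" "?b n"] p by simp
  have "0 \<le> 2 * (norm (?a n) powr (p - 2) * (norm (?b n))\<^sup>2)" for n by simp
  then have "0 \<le> ?g n" for n using gn order_trans by blast
  then have "sum ?g {i} \<le> suminf ?g"
    using g by (intro sum_le_suminf) (auto simp: sums_iff)
  then have "2 * (norm (?a i) powr (p - 2) * (norm (?b i))\<^sup>2) \<le>
      lp_norm p (\<lambda>n. ?a n + ?b n) powr p + lp_norm p (\<lambda>n. ?a n - ?b n) powr p - 2 * lp_norm p ?a powr p"
    using gn[of i] sums_unique[OF g] by simp
  moreover have "lp_norm p (\<lambda>n. ?a n + ?b n) powr p \<le> 1 + t powr p"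
    using bound[of "complex_of_real t"] t by simp
  moreover have "lp_norm p (\<lambda>n. ?a n - ?b n) powr p \<le> 1 + t powr p"
    using bound[of "- complex_of_real t"] t by simp
  moreover have "(norm (?b i))\<^sup>2 = t\<^sup>2 * (norm (S u i))\<^sup>2"
    by (simp add: norm_mult power_mult_distrib)
  ultimately show ?thesis by simp
qed

text \<open>The gain inequality gives \<open>\<kappa> powr (p - 2) * t\<^sup>2 * (norm (S u
  i))\<^sup>2 \<le> 2 * t powr p\<close> once the p-th power of the norm of \<open>S x\<close> is at
  least \<open>1 - t powr p\<close>. Dividing by the square of \<open>t\<close> leaves
  \<open>t powr (p - 2)\<close> on the right, which can be prescribed because \<open>p > 2\<close>.
  The resulting \<eta> is uniform in \<open>S\<close>, \<open>x\<close>, \<open>u\<close> and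
  \<open>i\<close>.\<close>

lemma contraction_entry_small:
  assumes p: "p > 2" and \<kappa>: "\<kappa> > 0" and e: "e > 0"
  shows "\<exists>\<eta>>0. \<forall>S\<in>lp_contractions p. \<forall>x\<in>lp_ball p. \<forall>u\<in>lp_ball p. \<forall>i.
    (\<forall>n. x n = 0 \<or> u n = 0) \<and> 1 - \<eta> \<le> lp_norm p (S x) \<and> \<kappa> \<le> norm (S x i) \<longrightarrow> norm (S u i) \<le> e"
proof -
  define t where "t = (\<kappa> powr (p - 2) * e\<^sup>2 / 2) powr (1 / (p - 2))"
  have t: "t > 0" unfolding t_def using \<kappa> e by simp
  have tp: "t powr (p - 2) = \<kappa> powr (p - 2) * e\<^sup>2 / 2"
    unfolding t_def using p \<kappa> e by (simp add: powr_powr)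
  \<comment> \<open>\<open>t\<close> may exceed 1, so the maximum with 0 keeps the base of the p-th
    root nonnegative.\<close>
  define m where "m = max 0 (1 - t powr p)"
  define \<eta> where "\<eta> = 1 - m powr (1 / p)"
  have m: "0 \<le> m" "m < 1" "1 - t powr p \<le> m" using t by (auto simp: m_def)
  have "m powr (1 / p) < 1 powr (1 / p)" using m p by (intro powr_less_mono2) auto
  then have "\<eta> > 0" by (simp add: \<eta>_def)
  moreover have "norm (S u i) \<le> e"
    if S: "S \<in> lp_contractions p" and x: "x \<in> lp_ball p" and u: "u \<in> lp_ball p"
      and disj: "\<forall>n. x n = 0 \<or> u n = 0" and Sx: "1 - \<eta> \<le> lp_norm p (S x)" "\<kappa> \<le> norm (S x i)" for S x u i
  proof -
    have "m = (1 - \<eta>) powr p" using m p by (simp add: \<eta>_def powr_powr)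
    also have "\<dots> \<le> lp_norm p (S x) powr p" using Sx p by (intro powr_mono2) (auto simp: \<eta>_def)
    finally have "1 - t powr p \<le> lp_norm p (S x) powr p" using m by simp
    then have "norm (S x i) powr (p - 2) * (t\<^sup>2 * (norm (S u i))\<^sup>2) \<le> 2 * t powr p"
      using contraction_disjoint_gain[OF p S x u, of t i] disj t by simp
    moreover have "\<kappa> powr (p - 2) * (t\<^sup>2 * (norm (S u i))\<^sup>2) \<le> norm (S x i) powr (p - 2) * (t\<^sup>2 * (norm (S u i))\<^sup>2)"
      using \<kappa> Sx p by (intro mult_right_mono powr_mono2) auto
    moreover have "t powr p = t\<^sup>2 * t powr (p - 2)"
      using t powr_add[of t 2 "p - 2"] by simp
    ultimately have "t\<^sup>2 * (\<kappa> powr (p - 2) * (norm (S u i))\<^sup>2) \<le> t\<^sup>2 * (\<kappa> powr (p - 2) * e\<^sup>2)"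
      by (simp add: tp mult_ac)
    then have "(norm (S u i))\<^sup>2 \<le> e\<^sup>2" using t \<kappa> by simp
    then show ?thesis using e by (simp add: power2_le_iff_abs_le)
  qed
  ultimately show ?thesis by blast
qed

section \<open>Perturbation to an almost norm attaining contraction\<close>

text \<open>Enlarging the first \<open>N\<close> entries of \<open>T u\<close> by \<open>\<delta>\<close> in modulus is a rank one perturbation at an
  almost maximizing \<open>x\<close>: multiply by a norming functional of \<open>x\<close> and align the phases.\<close>

lemma almost_norm_attaining_perturbation:
  assumes p: "p > 1" and T: "T \<in> lp_contractions p"
    and T_trunc: "\<And>u. u \<in> lp p \<Longrightarrow> T u = T (trunc M u)"
    and e: "trunc M e = e" "lp_norm p e = 1" "lp_norm p (T e) \<ge> 1"
    and \<delta>: "\<delta> > 0" and \<eta>: "\<eta> > 0"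
  shows "\<exists>R\<in>lp_contractions p. \<exists>x\<in>lp p.
    (\<forall>u\<in>lp p. R u = R (trunc M u)) \<and>
    (\<forall>u\<in>lp_ball p. lp_norm p (\<lambda>n. R u n - T u n) \<le> 2 * \<delta> * real N) \<and>
    trunc M x = x \<and> lp_norm p x = 1 \<and> 1 - \<eta> \<le> lp_norm p (R x) \<and>
    (\<forall>i<N. \<delta> / (1 + \<delta> * real N) \<le> norm (R x i))"
proof -
  have p1: "p \<ge> 1" using p by simp
  note Tlp = lp_contractionsD(1)[OF p1 T] and Tadd = lp_contractionsD(2)[OF p1 T]
    and Tscale = lp_contractionsD(3)[OF p1 T] and Tle = lp_contractionsD(4)[OF p1 T]
  define ind :: "nat \<Rightarrow> complex" where "ind = trunc N (\<lambda>_. 1)"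
  have ind: "ind \<in> lp p" unfolding ind_def by (rule trunc_lp[OF p1])
  have ind_norm: "lp_norm p ind \<le> real N"
  proof (rule powr_le_imp_le)
    have "lp_norm p ind powr p = real N" unfolding ind_def trunc_norm_powr[OF p1] by simp
    also have "real N \<le> real N powr p"
      using powr_mono[of 1 p "real N"] p by (cases "N = 0") auto
    finally show "lp_norm p ind powr p \<le> real N powr p" .
  qed (use p in auto)
  \<comment> \<open>\<open>h v\<close> bounds in modulus every vector \<open>Q v\<close> built
    below, and equals \<open>Q x\<close> in modulus at the chosen \<open>x\<close>. Therefore
    \<open>x\<close> is taken to almost maximize \<open>g\<close> rather than the norm of
    \<open>T u\<close>: then \<open>s\<close> bounds the perturbed operator and is almost reached at
    \<open>x\<close>.\<close>
  define h where "h u = (\<lambda>i. complex_of_real (norm (T u i)) + complex_of_real \<delta> * ind i)" for u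
  have norm_h: "norm (h u i) = norm (T u i) + \<delta> * norm (ind i)" for u i
  proof -
    have "h u i = complex_of_real (norm (T u i) + \<delta> * norm (ind i))"
      by (simp add: h_def ind_def trunc_def)
    then show ?thesis using \<delta> by (simp only: norm_of_real) simp
  qed
  define g where "g u = lp_norm p (h u)" for u
  have dind: "(\<lambda>i. complex_of_real \<delta> * ind i) \<in> lp p"
    "lp_norm p (\<lambda>i. complex_of_real \<delta> * ind i) \<le> \<delta> * real N"
    using lp_scale[OF p1 ind, of "complex_of_real \<delta>"] \<delta> ind_norm by simp_all
  have h: "h u \<in> lp p \<and> g u \<le> lp_norm p (T u) + \<delta> * real N" if u: "u \<in> lp p" for u
  proof -
    have a: "(\<lambda>i. complex_of_real (norm (T u i))) \<in> lp p"
      by (rule lp_mono(1)[OF p1 Tlp[OF u]]) simp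
    have "lp_norm p (\<lambda>i. complex_of_real (norm (T u i))) = lp_norm p (T u)"
      by (rule lp_norm_cong_norm) simp
    then show ?thesis
      unfolding g_def h_def using lp_add[OF p1 a dind(1)] dind(2) by simp
  qed
  define S where "S = {x. trunc M x = x \<and> lp_norm p x = 1}"
  have S_lp: "x \<in> lp p" if "x \<in> S" for x
    using that trunc_lp[OF p1, of M x] by (simp add: S_def)
  have eS: "e \<in> S" using e by (simp add: S_def)
  have gle: "g u \<le> 1 + \<delta> * real N" if "u \<in> S" for u
    using h[OF S_lp[OF that]] Tle[OF S_lp[OF that]] that by (simp add: S_def)
  have bdd: "bdd_above (g ` S)" using gle by (rule bdd_aboveI2)
  define s where "s = (SUP u\<in>S. g u)"
  have gs: "g u \<le> s" if "u \<in> S" for u unfolding s_def by (rule cSUP_upper[OF that bdd])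
  have "lp_norm p (T e) \<le> g e"
    unfolding g_def
    by (rule lp_mono(2)[OF p1 conjunct1[OF h[OF S_lp[OF eS]]]]) (use norm_h \<delta> in simp)
  \<comment> \<open>The given vector \<open>e\<close> of full norm forces \<open>s \<ge> 1\<close>.
    Together with the upper bound for \<open>s\<close>, this makes the later division by
    \<open>s\<close> a small change.\<close>
  then have s1: "s \<ge> 1" using gs[OF eS] e(3) by linarith
  have s2: "s \<le> 1 + \<delta> * real N" unfolding s_def using eS gle by (intro cSUP_least) auto
  have "s - \<eta> < s" using \<eta> by simp
  then obtain x where x: "x \<in> S" "g x > s - \<eta>"
    unfolding s_def using less_cSUP_iff[OF _ bdd] eS by blast
  have xlp: "x \<in> lp p" and xtr: "trunc M x = x" and xn: "lp_norm p x = 1"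
    using S_lp x by (auto simp: S_def)
  \<comment> \<open>The coefficients of the duality map at the unit vector \<open>x\<close>: the
    functional \<open>\<phi>\<close> built from them has norm at most 1 and value 1 at
    \<open>x\<close>.\<close>
  define \<xi> where "\<xi> k = cnj (sgn (x k)) * complex_of_real (norm (x k) powr (p - 1))" for k
  define \<phi> where "\<phi> u = (\<Sum>k<M. \<xi> k * u k)" for u :: "nat \<Rightarrow> complex"
  have norm_\<xi>: "norm (\<xi> k) = norm (x k) powr (p - 1)" for k
    using p by (cases "x k = 0") (auto simp: \<xi>_def norm_mult norm_sgn)
  have xsum: "(\<Sum>k<M. norm (x k) powr p) = 1"
    using trunc_norm_powr[OF p1, of M x] xtr xn by simp
  have \<phi>x: "\<phi> x = 1"
  proof -
    have "\<xi> k * x k = complex_of_real (norm (x k) powr p)" for k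
    proof (cases "x k = 0")
      case False
      have "cnj (sgn (x k)) * x k = complex_of_real (norm (x k))"
        using False by (simp add: sgn_eq complex_norm_square[symmetric] power2_eq_square mult.commute[of "cnj _"])
      then have "\<xi> k * x k = complex_of_real (norm (x k) * norm (x k) powr (p - 1))"
        by (simp add: \<xi>_def mult_ac)
      then show ?thesis using False by (simp add: powr_mult_base)
    qed (use p in \<open>simp add: \<xi>_def\<close>)
    then show ?thesis unfolding \<phi>_def using xsum by (simp flip: of_real_sum)
  qed
  \<comment> \<open>Young's inequality can be summed directly in place of Hoelder's, because both
    p-th power sums are at most 1 and \<open>1 / q + 1 / p = 1\<close>.\<close>
  have \<phi>_le: "norm (\<phi> u) \<le> 1" if u: "u \<in> lp_ball p" for u
  proof -
    define q where "q = p / (p - 1)"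
    have q: "q > 1" "1 / q + 1 / p = 1" "(p - 1) * q = p" using p by (auto simp: q_def field_simps)
    have "norm (\<phi> u) \<le> (\<Sum>k<M. norm (x k) powr p / q + norm (u k) powr p / p)"
      unfolding \<phi>_def
    proof (rule sum_norm_le)
      fix k
      show "norm (\<xi> k * u k) \<le> norm (x k) powr p / q + norm (u k) powr p / p"
        using Youngs_inequality[OF q(1) p q(2), of "norm (x k) powr (p - 1)" "norm (u k)"] q(3)
        by (simp add: norm_mult norm_\<xi> powr_powr)
    qed
    also have "\<dots> = 1 / q + (\<Sum>k<M. norm (u k) powr p) / p"
      by (simp add: sum.distrib xsum flip: sum_divide_distrib)
    also have "(\<Sum>k<M. norm (u k) powr p) \<le> lp_norm p u powr p"
      using u by (intro partial_le_lp_norm[OF p1]) auto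
    also have "\<dots> \<le> 1 powr p" using u p by (intro powr_mono2) auto
    finally show ?thesis using q(2) p by (simp add: divide_right_mono)
  qed
  have \<phi>_add: "\<phi> (\<lambda>n. u n + v n) = \<phi> u + \<phi> v" for u v
    by (simp add: \<phi>_def distrib_left sum.distrib)
  have \<phi>_scale: "\<phi> (\<lambda>n. c * u n) = c * \<phi> u" for c u
    by (simp add: \<phi>_def sum_distrib_left mult_ac)
  have \<phi>_trunc: "\<phi> (trunc M u) = \<phi> u" for u by (simp add: \<phi>_def trunc_def)
  \<comment> \<open>Phases of \<open>T x\<close>, with default 1 at its zeros: there the
    perturbation must still contribute an entry of modulus \<delta> to the first \<open>N\<close>
    coordinates.\<close>
  define \<theta> where "\<theta> i = (if T x i = 0 then 1 else sgn (T x i))" for i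
  have \<theta>: "norm (\<theta> i) = 1" "T x i = \<theta> i * complex_of_real (norm (T x i))" for i
    by (simp add: \<theta>_def norm_sgn) (simp add: \<theta>_def sgn_eq)
  define w where "w i = complex_of_real \<delta> * (\<theta> i * ind i)" for i
  have norm_w: "norm (w i) = \<delta> * norm (ind i)" for i using \<delta> \<theta> by (simp add: w_def norm_mult)
  have w: "w \<in> lp p" "lp_norm p w \<le> \<delta> * real N"
  proof -
    have le: "norm (w i) \<le> norm (complex_of_real \<delta> * ind i)" for i
      using norm_w \<delta> by (simp add: norm_mult)
    show "w \<in> lp p" "lp_norm p w \<le> \<delta> * real N"
      using lp_mono[OF p1 dind(1) le] dind(2) by auto
  qed
  define Q where "Q u = (\<lambda>i. T u i + \<phi> u * w i)" for u
  have Q_lp: "Q u \<in> lp p" if "u \<in> lp p" for u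
    unfolding Q_def using that by (intro lp_add(1)[OF p1] Tlp lp_scale(1)[OF p1] w)
  have Q_scale: "Q (\<lambda>n. c * u n) = (\<lambda>n. c * Q u n)" if "u \<in> lp p" for c u
    unfolding Q_def Tscale[OF that] \<phi>_scale by (simp add: algebra_simps)
  have Q_trunc: "Q (trunc M u) = Q u" if "u \<in> lp p" for u
    unfolding Q_def \<phi>_trunc T_trunc[OF that, symmetric] by simp
  have Q_S: "lp_norm p (Q v) \<le> s" if v: "v \<in> S" for v
  proof -
    have "norm (Q v i) \<le> norm (h v i)" for i
    proof -
      have "norm (\<phi> v) \<le> 1" using \<phi>_le S_lp[OF v] v by (simp add: S_def)
      then have "norm (\<phi> v * w i) \<le> norm (w i)" by (simp add: norm_mult mult_left_le_one_le)
      then show ?thesis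
        unfolding Q_def norm_h using norm_triangle_ineq[of "T v i" "\<phi> v * w i"] norm_w[of i] by linarith
    qed
    from lp_mono(2)[OF p1 conjunct1[OF h[OF S_lp[OF v]]] this] gs[OF v] show ?thesis
      unfolding g_def by linarith
  qed
  have Q_le: "lp_norm p (Q u) \<le> s * lp_norm p u" if u: "u \<in> lp p" for u
  proof (cases "lp_norm p (trunc M u) = 0")
    case True
    then have "trunc M u = (\<lambda>n. 0)" using lp_norm_eq_0[OF p1 trunc_lp[OF p1]] by blast
    then have "Q u = (\<lambda>n. 0)"
      using Q_trunc[OF u] by (simp add: Q_def lp_contractions_zero[OF p1 T] \<phi>_def)
    then show ?thesis using s1 by simp
  next
    case False
    define r where "r = lp_norm p (trunc M u)"
    have r: "r > 0" using False lp_norm_nonneg[of p "trunc M u"] unfolding r_def by linarith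
    define v where "v = (\<lambda>n. complex_of_real (inverse r) * trunc M u n)"
    have ni: "norm (complex_of_real (inverse r)) = inverse r" "norm (complex_of_real r) = r"
      using r by (simp_all only: norm_of_real) simp_all
    have "lp_norm p v = 1"
      unfolding v_def lp_scale(2)[OF p1 trunc_lp[OF p1]] ni using r by (simp flip: r_def)
    moreover have "trunc M v = v" unfolding v_def by (auto simp: trunc_def)
    ultimately have vS: "v \<in> S" by (simp add: S_def)
    have "trunc M u = (\<lambda>n. complex_of_real r * v n)"
      unfolding v_def using r by (simp add: mult.assoc[symmetric] flip: of_real_mult)
    then have "Q u = (\<lambda>n. complex_of_real r * Q v n)"
      using Q_trunc[OF u] Q_scale[OF S_lp[OF vS], of "complex_of_real r"] by simp
    then have "lp_norm p (Q u) = r * lp_norm p (Q v)"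
      using lp_scale(2)[OF p1 Q_lp[OF S_lp[OF vS]], of "complex_of_real r"] ni by simp
    also have "\<dots> \<le> r * s" using Q_S[OF vS] r by (intro mult_left_mono) auto
    also have "\<dots> \<le> lp_norm p u * s"
      unfolding r_def using trunc_norm_le(1)[OF p1 u] s1 by (intro mult_right_mono) auto
    finally show ?thesis by (simp add: mult.commute)
  qed
  define R where "R = (\<lambda>u\<in>lp p. \<lambda>i. complex_of_real (inverse s) * Q u i)"
  have R: "R u = (\<lambda>i. complex_of_real (inverse s) * Q u i)" if "u \<in> lp p" for u
    using that by (simp add: R_def)
  have ns: "norm (complex_of_real (inverse s)) = inverse s" using s1 by (simp only: norm_of_real) simp
  have R_norm: "lp_norm p (R u) = inverse s * lp_norm p (Q u)" if "u \<in> lp p" for u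
    unfolding R[OF that] lp_scale(2)[OF p1 Q_lp[OF that]] ns ..
  have RC: "R \<in> lp_contractions p"
  proof (rule lp_contractionsI[OF p1])
    show "R \<in> lp p \<rightarrow>\<^sub>E lp p"
      using R lp_scale(1)[OF p1 Q_lp] by (auto simp: PiE_iff R_def restrict_extensional)
    show "R (\<lambda>n. y n + z n) = (\<lambda>n. R y n + R z n)" if "y \<in> lp p" "z \<in> lp p" for y z
      unfolding R[OF that(1)] R[OF that(2)] R[OF lp_add(1)[OF p1 that]] Q_def Tadd[OF that] \<phi>_add
      by (simp add: algebra_simps)
    show "R (\<lambda>n. c * y n) = (\<lambda>n. c * R y n)" if "y \<in> lp p" for c y
      unfolding R[OF that] R[OF lp_scale(1)[OF p1 that]] Q_scale[OF that] by (simp add: mult_ac)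
    show "lp_norm p (R u) \<le> lp_norm p u" if "u \<in> lp p" for u
      unfolding R_norm[OF that] using Q_le[OF that] s1 by (simp add: field_simps)
  qed
  have R_trunc: "R u = R (trunc M u)" if "u \<in> lp p" for u
    unfolding R[OF that] R[OF trunc_lp[OF p1]] Q_trunc[OF that] ..
  have close: "lp_norm p (\<lambda>n. R u n - T u n) \<le> 2 * \<delta> * real N" if "u \<in> lp_ball p" for u
  proof -
    have u: "u \<in> lp p" "lp_norm p u \<le> 1" using that by auto
    \<comment> \<open>Two errors of size at most \<open>\<delta> * real N\<close>: the rank one term
      with coefficient \<open>c\<close>, and the rescaling of \<open>T\<close> with coefficient
      \<open>d\<close>, bounded through \<open>1 - inverse s \<le> s - 1\<close>.\<close>
    define c where "c = complex_of_real (inverse s) * \<phi> u"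
    define d where "d = complex_of_real (inverse s - 1)"
    have eq: "(\<lambda>n. R u n - T u n) = (\<lambda>n. c * w n + d * T u n)"
      unfolding R[OF u(1)] Q_def c_def d_def by (simp add: algebra_simps)
    have inv_s: "inverse s \<le> 1" "inverse s > 0" using s1 by (auto simp: field_simps)
    have "norm c \<le> 1"
      unfolding c_def norm_mult ns using \<phi>_le[OF that] inv_s by (intro mult_le_one) auto
    then have c: "norm c * lp_norm p w \<le> 1 * (\<delta> * real N)"
      using w(2) by (intro mult_mono) auto
    have "norm d = 1 - inverse s"
      unfolding d_def norm_of_real using inv_s by simp
    also have "\<dots> \<le> s - 1"
      using s1 mult_right_mono[of 1 s "s - 1"] by (simp add: field_simps)
    finally have "norm d \<le> \<delta> * real N" using s2 by linarith
    then have d: "norm d * lp_norm p (T u) \<le> (\<delta> * real N) * 1"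
      using Tle[OF u(1)] u(2) \<delta> by (intro mult_mono) auto
    have "lp_norm p (\<lambda>n. R u n - T u n) \<le> norm c * lp_norm p w + norm d * lp_norm p (T u)"
      unfolding eq lp_scale(2)[OF p1 w(1), symmetric] lp_scale(2)[OF p1 Tlp[OF u(1)], symmetric]
      by (intro lp_add(2)[OF p1] lp_scale(1)[OF p1] w Tlp u)
    then show ?thesis using c d by linarith
  qed
  have Qx: "norm (Q x i) = norm (h x i)" for i
  proof -
    have "Q x i = \<theta> i * complex_of_real (norm (T x i)) + w i"
      unfolding Q_def \<phi>x mult_1 by (rule arg_cong[where f = "\<lambda>z. z + w i"]) (rule \<theta>(2))
    also have "\<dots> = \<theta> i * h x i" by (simp add: w_def h_def algebra_simps)
    finally show ?thesis using \<theta>(1) by (simp add: norm_mult)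
  qed
  have "lp_norm p (Q x) = g x" unfolding g_def by (rule lp_norm_cong_norm[OF Qx])
  then have "s - \<eta> \<le> lp_norm p (Q x)" using x(2) by linarith
  then have "inverse s * (s - \<eta>) \<le> lp_norm p (R x)"
    unfolding R_norm[OF xlp] using s1 by (intro mult_left_mono) auto
  moreover have "1 - \<eta> \<le> inverse s * (s - \<eta>)"
    using s1 \<eta> by (simp add: field_simps)
  ultimately have Rx: "1 - \<eta> \<le> lp_norm p (R x)" by linarith
  have entry: "\<delta> / (1 + \<delta> * real N) \<le> norm (R x i)" if "i < N" for i
  proof -
    have "norm (R x i) = norm (Q x i) / s"
      unfolding R[OF xlp] norm_mult ns by (simp add: divide_inverse mult.commute)
    also have "\<dots> \<ge> \<delta> / (1 + \<delta> * real N)"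
      unfolding Qx norm_h using that s1 s2 \<delta> by (intro frac_le) (auto simp: ind_def trunc_def)
    finally show ?thesis .
  qed
  show ?thesis using RC xlp R_trunc close xtr xn Rx entry by blast
qed

text \<open>The compression and the identity on coordinate \<open>K\<close> have disjoint domains
  and ranges, so p-th powers of norms add. The fixed vector \<open>unit_seq K\<close> provides full
  norm however small the compression of \<open>T\<close> is.\<close>

lemma block_contraction:
  assumes p: "p \<ge> 1" and T: "T \<in> lp_contractions p"
  shows "(\<lambda>u\<in>lp p. \<lambda>n. trunc K (T (trunc K u)) n + u K * unit_seq K n) \<in> lp_contractions p"
    (is "?B \<in> _")
proof (rule lp_contractionsI[OF p])
  note Tlp = lp_contractionsD(1)[OF p T]
  have tt: "trunc K u \<in> lp p" for u by (rule trunc_lp[OF p])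
  have uK: "(\<lambda>n. c * unit_seq K n) \<in> lp p" "lp_norm p (\<lambda>n. c * unit_seq K n) = norm c" for c
    using lp_scale[OF p unit_seq_lp[OF p], of c K] p by auto
  show "?B \<in> lp p \<rightarrow>\<^sub>E lp p"
    using lp_add(1)[OF p tt uK(1)] by (auto simp: PiE_iff restrict_extensional)
  show "?B (\<lambda>n. y n + z n) = (\<lambda>n. ?B y n + ?B z n)" if "y \<in> lp p" "z \<in> lp p" for y z
    using that lp_add(1)[OF p that] lp_contractionsD(2)[OF p T tt tt]
    by (simp add: trunc_add algebra_simps)
  show "?B (\<lambda>n. c * y n) = (\<lambda>n. c * ?B y n)" if "y \<in> lp p" for c y
    using that lp_scale(1)[OF p that] lp_contractionsD(3)[OF p T tt]
    by (simp add: trunc_scale algebra_simps)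
  show "lp_norm p (?B u) \<le> lp_norm p u" if u: "u \<in> lp p" for u
  proof (rule powr_le_imp_le)
    have "lp_norm p (?B u) powr p = lp_norm p (trunc K (T (trunc K u))) powr p + norm (u K) powr p"
      using u lp_norm_powr_add_disjoint[OF p tt uK(1), of "T (trunc K u)" "u K"] uK(2)
      by (auto simp: trunc_def unit_seq_def)
    also have "\<dots> \<le> lp_norm p (trunc K u) powr p + norm (u K) powr p"
      using order_trans[OF trunc_norm_le(1)[OF p Tlp[OF tt]] lp_contractionsD(4)[OF p T tt]] p
      by (intro add_right_mono powr_mono2) auto
    also have "lp_norm p (trunc K u) powr p + norm (u K) powr p = lp_norm p (trunc (Suc K) u) powr p"
      by (simp add: trunc_norm_powr[OF p])
    also have "\<dots> \<le> lp_norm p u powr p"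
      using trunc_norm_le(1)[OF p u] p by (intro powr_mono2) auto
    finally show "lp_norm p (?B u) powr p \<le> lp_norm p u powr p" .
  qed (use p in auto)
qed


section \<open>\<open>SOT\<^sup>*\<close>-open sets have nonempty SOT-interior\<close>

text \<open>The perturbed operator pins down, among contractions close to it in SOT, both its first
  columns and its first rows; hence a SOT-ball around it lies in the given \<open>SOT\<^sup>*\<close>-open set.\<close>

lemma SOT_star_open_contains_SOT_ball:
  assumes p: "p > 2" and V: "openin (lp_SOT_star p) V" and ne: "V \<noteq> {}"
  shows "\<exists>R\<in>lp_contractions p. \<exists>r>0. \<forall>S\<in>lp_contractions p. lp_opdist p S R < r \<longrightarrow> S \<in> V"
proof -
  have p1: "p \<ge> 1" "p > 1" using p by auto
  obtain T0 where T0: "T0 \<in> V" using ne by blast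
  then have T0C: "T0 \<in> lp_contractions p"
    using openin_subset[OF V] topspace_lp_SOT_star[OF p1(1)] by auto
  note T0lp = lp_contractionsD(1)[OF p1(1) T0C]
  obtain N where N: "\<And>S. S \<in> lp_contractions p \<Longrightarrow>
      (\<forall>j<N. lp_norm p (\<lambda>n. S (unit_seq j) n - T0 (unit_seq j) n) \<le> 1 / (real N + 1) \<and>
        (\<forall>u\<in>lp_ball p. norm (S u j - T0 u j) \<le> 1 / (real N + 1))) \<Longrightarrow> S \<in> V"
    using SOT_star_neighbourhood[OF p1(2) V T0] by blast
  define e where "e = 1 / (real N + 1)"
  have e: "e > 0" by (simp add: e_def)
  have ball_unit: "unit_seq j \<in> lp_ball p" for j using p1 by simp
  have row_dual: "(\<lambda>x\<in>lp p. T0 x j) \<in> lp_dual p" for j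
  proof -
    have "norm (T0 x j) \<le> 1 * lp_norm p x" if "x \<in> lp p" for x
      using lp_coord_le[OF p1(1) T0lp[OF that], of j] lp_contractionsD(4)[OF p1(1) T0C that] by simp
    then have bound: "\<exists>C. \<forall>x\<in>lp p. norm ((\<lambda>x\<in>lp p. T0 x j) x) \<le> C * lp_norm p x"
      by (intro exI[of _ 1]) simp
    show ?thesis
      unfolding lp_dual_def using bound lp_add(1)[OF p1(1)] lp_scale(1)[OF p1(1)]
        lp_contractionsD(2,3)[OF p1(1) T0C] by auto
  qed
  have "\<forall>\<^sub>F K in sequentially. N \<le> K \<and>
      (\<forall>j\<in>{..<N}. lp_norm p (\<lambda>n. T0 (unit_seq j) n - trunc K (T0 (unit_seq j)) n) < e / 4 \<and>
        (\<forall>u\<in>lp_ball p. (\<forall>n<K. u n = 0) \<longrightarrow> norm (T0 u j) \<le> e / 4))"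
  proof (rule eventually_conj[OF eventually_ge_at_top],
      rule eventually_ball_finite[OF finite_lessThan], rule ballI, rule eventually_conj)
    fix j
    have "T0 (unit_seq j) \<in> lp p" using p1 by (intro T0lp) simp
    from trunc_tail_tendsto[OF p1(1) this]
    have "\<forall>\<^sub>F K in sequentially. dist (lp_norm p (\<lambda>n. T0 (unit_seq j) n - trunc K (T0 (unit_seq j)) n)) 0 < e / 4"
      unfolding tendsto_iff using divide_pos_pos[OF e zero_less_numeral] by blast
    then show "\<forall>\<^sub>F K in sequentially. lp_norm p (\<lambda>n. T0 (unit_seq j) n - trunc K (T0 (unit_seq j)) n) < e / 4"
      by simp
    obtain K0 where K0: "\<forall>u\<in>lp_ball p. (\<forall>n<K0. u n = 0) \<longrightarrow> norm ((\<lambda>x\<in>lp p. T0 x j) u) \<le> e / 4"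
      using lp_dual_tail_small[OF p1(2) row_dual[of j], of "e / 4"] e by auto
    show "\<forall>\<^sub>F K in sequentially. \<forall>u\<in>lp_ball p. (\<forall>n<K. u n = 0) \<longrightarrow> norm (T0 u j) \<le> e / 4"
      by (rule eventually_sequentiallyI[of K0]) (use K0 in auto)
  qed
  \<comment> \<open>Cutting to \<open>K\<close> coordinates now changes each of the first
    \<open>N\<close> columns by less than \<open>e / 4\<close> and each of the first
    \<open>N\<close> rows by at most \<open>e / 4\<close> on the unit ball; \<open>N \<le> K\<close>
    keeps the identity block away from both.\<close>
  then obtain K where K: "N \<le> K"
    and colT0: "\<And>j. j < N \<Longrightarrow> lp_norm p (\<lambda>n. T0 (unit_seq j) n - trunc K (T0 (unit_seq j)) n) < e / 4"
    and rowT0: "\<And>j u. j < N \<Longrightarrow> u \<in> lp_ball p \<Longrightarrow> \<forall>n<K. u n = 0 \<Longrightarrow> norm (T0 u j) \<le> e / 4"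
    unfolding eventually_sequentially by blast
  define B where "B = (\<lambda>u\<in>lp p. \<lambda>n. trunc K (T0 (trunc K u)) n + u K * unit_seq K n)"
  have BC: "B \<in> lp_contractions p" unfolding B_def by (rule block_contraction[OF p1(1) T0C])
  have B: "B u = (\<lambda>n. trunc K (T0 (trunc K u)) n + u K * unit_seq K n)" if "u \<in> lp p" for u
    using that by (simp add: B_def)
  \<comment> \<open>One coordinate more than the compression, to include the block at index
    \<open>K\<close>.\<close>
  let ?M = "Suc K"
  have B_trunc: "B u = B (trunc ?M u)" if "u \<in> lp p" for u
    unfolding B[OF that] B[OF trunc_lp[OF p1(1)]] by (simp add: min_def) (simp add: trunc_def)
  have eK: "trunc ?M (unit_seq K) = unit_seq K" "trunc K (unit_seq K) = (\<lambda>n. 0)"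
    by (auto simp: trunc_def unit_seq_def fun_eq_iff)
  have uK: "unit_seq K \<in> lp p" using p1 by simp
  have "B (unit_seq K) = unit_seq K"
    unfolding B[OF uK] eK lp_contractions_zero[OF p1(1) T0C]
    by (auto simp: trunc_def unit_seq_def fun_eq_iff)
  then have B_eK: "lp_norm p (B (unit_seq K)) \<ge> 1" using p1 by simp
  \<comment> \<open>Makes the perturbation error \<open>2 * \<delta> * real N\<close> at most
    \<open>e / 4\<close>.\<close>
  define \<delta> where "\<delta> = e / (8 * (real N + 1))"
  have \<delta>: "\<delta> > 0" using e by (simp add: \<delta>_def)
  have \<delta>N: "2 * \<delta> * real N \<le> e / 4"
    using e by (simp add: \<delta>_def field_simps)
  \<comment> \<open>Half of the guaranteed entry size of \<open>R x\<close>; the other half may be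
    lost in passing from \<open>R\<close> to \<open>S\<close>. The defect \<eta> is halved below for
    the same reason.\<close>
  define \<kappa> where "\<kappa> = \<delta> / (1 + \<delta> * real N) / 2"
  have \<kappa>: "\<kappa> > 0" unfolding \<kappa>_def using \<delta> by (simp add: add_pos_nonneg)
  obtain \<eta> where \<eta>: "\<eta> > 0"
    and small: "\<And>S x u i. S \<in> lp_contractions p \<Longrightarrow> x \<in> lp_ball p \<Longrightarrow> u \<in> lp_ball p \<Longrightarrow>
      \<forall>n. x n = 0 \<or> u n = 0 \<Longrightarrow> 1 - \<eta> \<le> lp_norm p (S x) \<Longrightarrow> \<kappa> \<le> norm (S x i) \<Longrightarrow> norm (S u i) \<le> e / 8"
    using contraction_entry_small[OF p \<kappa>, of "e / 8"] e by auto
  obtain R x where RC: "R \<in> lp_contractions p" and x: "x \<in> lp p" "trunc ?M x = x" "lp_norm p x = 1"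
    and R_trunc: "\<And>u. u \<in> lp p \<Longrightarrow> R u = R (trunc ?M u)"
    and close: "\<And>u. u \<in> lp_ball p \<Longrightarrow> lp_norm p (\<lambda>n. R u n - B u n) \<le> 2 * \<delta> * real N"
    and Rx: "1 - \<eta> / 2 \<le> lp_norm p (R x)" "\<And>i. i < N \<Longrightarrow> \<delta> / (1 + \<delta> * real N) \<le> norm (R x i)"
    using almost_norm_attaining_perturbation[OF p1(2) BC B_trunc eK(1) lp_norm_unit_seq[OF p1(1)] B_eK \<delta>
        half_gt_zero[OF \<eta>], of N] by blast
  define \<rho> where "\<rho> = min (e / 8) (min (\<eta> / 2) \<kappa>)"
  have \<rho>: "\<rho> > 0" "\<rho> \<le> e / 8" "\<rho> \<le> \<eta> / 2" "\<rho> \<le> \<kappa>" using e \<eta> \<kappa> by (auto simp: \<rho>_def)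
  \<comment> \<open>One factor \<open>real ?M\<close> compensates the weights in
    \<open>lp_opdist\<close>, the other the expansion of a truncated vector into columns.\<close>
  define r where "r = \<rho> / (real ?M * real ?M)"
  have r: "r > 0" using \<rho> by (simp add: r_def)
  have "S \<in> V" if SC: "S \<in> lp_contractions p" and Sr: "lp_opdist p S R < r" for S
  proof -
    note Slp = lp_contractionsD(1)[OF p1(1) SC] and Rlp = lp_contractionsD(1)[OF p1(1) RC]
      and Blp = lp_contractionsD(1)[OF p1(1) BC]
    have cols: "lp_norm p (\<lambda>n. S (unit_seq j) n - R (unit_seq j) n) \<le> real ?M * r" if "j < ?M" for j
    proof -
      have "lp_norm p (\<lambda>n. S (unit_seq j) n - R (unit_seq j) n) \<le> (real j + 1) * lp_opdist p S R"
        by (rule lp_opdist_upper[OF p1(1) SC RC])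
      also have "\<dots> \<le> real ?M * r"
        using that Sr Metric_space.nonneg[OF Metric_space_lp_opdist[OF p1(1)], of S R]
        by (intro mult_mono) auto
      finally show ?thesis .
    qed
    have SR: "lp_norm p (\<lambda>n. S (trunc ?M u) n - R u n) \<le> \<rho>" if "u \<in> lp_ball p" for u
    proof -
      have u: "u \<in> lp p" "lp_norm p u \<le> 1" using that by auto
      have "lp_norm p (\<lambda>n. S (trunc ?M u) n - R (trunc ?M u) n) \<le> real ?M * lp_norm p u * (real ?M * r)"
        by (rule contractions_diff_trunc[OF p1(1) SC RC u(1) cols])
      also have "\<dots> \<le> real ?M * 1 * (real ?M * r)"
        using u r by (intro mult_right_mono mult_left_mono) auto
      also have "\<dots> = \<rho>" by (simp add: r_def del: of_nat_Suc)
      finally show ?thesis using R_trunc[OF u(1)] by simp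
    qed
    have xb: "x \<in> lp_ball p" using x by simp
    have SRx: "lp_norm p (\<lambda>n. S x n - R x n) \<le> \<rho>" using SR[OF xb] x by simp
    have "lp_norm p (R x) \<le> lp_norm p (S x) + lp_norm p (\<lambda>n. S x n - R x n)"
      using lp_diff_norm[OF p1(1) Slp[OF x(1)] lp_diff[OF p1(1) Slp[OF x(1)] Rlp[OF x(1)]]] by simp
    then have Sx: "1 - \<eta> \<le> lp_norm p (S x)" using SRx Rx(1) \<rho> by linarith
    have Sxi: "\<kappa> \<le> norm (S x i)" if "i < N" for i
    proof -
      have "norm (S x i - R x i) \<le> \<rho>"
        using lp_coord_le[OF p1(1) lp_diff[OF p1(1) Slp[OF x(1)] Rlp[OF x(1)]], of i] SRx by linarith
      moreover have "norm (R x i) \<le> norm (S x i) + norm (S x i - R x i)"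
        using norm_triangle_ineq4[of "S x i" "S x i - R x i"] by simp
      moreover have "2 * \<kappa> \<le> norm (R x i)" using Rx(2)[OF that] by (simp only: \<kappa>_def mult_2 field_sum_of_halves)
      ultimately show ?thesis using \<rho> by linarith
    qed
    have col: "lp_norm p (\<lambda>n. S (unit_seq j) n - T0 (unit_seq j) n) \<le> e" if j: "j < N" for j
    proof -
      let ?u = "unit_seq j"
      have u: "?u \<in> lp p" using p1 by simp
      have tr: "trunc ?M ?u = ?u" "trunc K ?u = ?u" "?u K = 0"
        using j K by (auto simp: trunc_def unit_seq_def fun_eq_iff)
      have "B ?u = trunc K (T0 ?u)" unfolding B[OF u] tr by simp
      then have "lp_norm p (\<lambda>n. B ?u n - T0 ?u n) \<le> e / 4"
        using colT0[OF j] lp_norm_minus[of p "B ?u" "T0 ?u"] by simp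
      moreover have "lp_norm p (\<lambda>n. S ?u n - R ?u n) \<le> \<rho>" using SR[OF ball_unit, of j] unfolding tr .
      moreover have "lp_norm p (\<lambda>n. R ?u n - B ?u n) \<le> e / 4" using close[OF ball_unit] \<delta>N by (rule order_trans)
      moreover have "lp_norm p (\<lambda>n. S ?u n - T0 ?u n) \<le>
          lp_norm p (\<lambda>n. S ?u n - R ?u n) + lp_norm p (\<lambda>n. R ?u n - T0 ?u n)"
        by (rule lp_diff_triangle[OF p1(1) Slp[OF u] Rlp[OF u] T0lp[OF u]])
      moreover have "lp_norm p (\<lambda>n. R ?u n - T0 ?u n) \<le>
          lp_norm p (\<lambda>n. R ?u n - B ?u n) + lp_norm p (\<lambda>n. B ?u n - T0 ?u n)"
        by (rule lp_diff_triangle[OF p1(1) Rlp[OF u] Blp[OF u] T0lp[OF u]])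
      ultimately show ?thesis using \<rho> e by linarith
    qed
    \<comment> \<open>SOT-closeness handles \<open>S\<close> on the first \<open>?M\<close>
      coordinates only. The remaining tail of \<open>u\<close> is disjoint from \<open>x\<close>, so
      rigidity bounds it by \<open>e / 8\<close>; the errors from \<open>S\<close> to
      \<open>R\<close>, \<open>R\<close> to \<open>B\<close> and \<open>B\<close> to
      \<open>T0\<close> add at most \<open>e / 8\<close>, \<open>e / 4\<close> and
      \<open>e / 4\<close>.\<close>
    have row: "norm (S u j - T0 u j) \<le> e" if j: "j < N" and ub: "u \<in> lp_ball p" for j u
    proof -
      have u: "u \<in> lp p" "lp_norm p u \<le> 1" using ub by auto
      have tail: "(\<lambda>n. u n - trunc m u n) \<in> lp_ball p" for m
        using lp_diff[OF p1(1) u(1) trunc_lp[OF p1(1)]] trunc_norm_le(2)[OF p1(1) u(1), of m] u(2) by auto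
      have "norm (S (\<lambda>n. u n - trunc ?M u n) j) \<le> e / 8"
      proof (rule small[OF SC xb tail _ Sx Sxi[OF j]])
        have "x n = 0" if "n \<ge> ?M" for n using fun_cong[OF x(2), of n] that by (simp add: trunc_def)
        then show "\<forall>n. x n = 0 \<or> u n - trunc ?M u n = 0" by (auto simp: trunc_def)
      qed
      moreover have "S (\<lambda>n. u n - trunc ?M u n) j = S u j - S (trunc ?M u) j"
        using lp_contractions_diff[OF p1(1) SC u(1) trunc_lp[OF p1(1)]] by simp
      moreover have "norm (S (trunc ?M u) j - R u j) \<le> \<rho>"
        using lp_coord_le[OF p1(1) lp_diff[OF p1(1) Slp[OF trunc_lp[OF p1(1)]] Rlp[OF u(1)]]] SR[OF ub]
        by (rule order_trans)
      moreover have "norm (R u j - B u j) \<le> e / 4"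
        using lp_coord_le[OF p1(1) lp_diff[OF p1(1) Rlp[OF u(1)] Blp[OF u(1)]], of j] close[OF ub] \<delta>N
        by linarith
      moreover have "norm (T0 u j - B u j) \<le> e / 4"
      proof -
        have "B u j = T0 (trunc K u) j"
          unfolding B[OF u(1)] using j K by (simp add: trunc_def unit_seq_def)
        then have "T0 u j - B u j = T0 (\<lambda>n. u n - trunc K u n) j"
          using lp_contractions_diff[OF p1(1) T0C u(1) trunc_lp[OF p1(1)], of K] by simp
        then show ?thesis using rowT0[OF j tail, of K] by (simp add: trunc_def)
      qed
      moreover have "norm (S u j - T0 u j) \<le> norm (S u j - S (trunc ?M u) j) + norm (S (trunc ?M u) j - R u j)
          + norm (R u j - B u j) + norm (T0 u j - B u j)"
      proof -
        have "norm (a + b + c - d) \<le> norm a + norm b + norm c + norm d" for a b c d :: complex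
          using norm_triangle_ineq4[of "a + b + c" d] norm_triangle_ineq[of "a + b" c]
            norm_triangle_ineq[of a b] by linarith
        from this[of "S u j - S (trunc ?M u) j" "S (trunc ?M u) j - R u j" "R u j - B u j" "T0 u j - B u j"]
        show ?thesis by simp
      qed
      ultimately show ?thesis using \<rho> e by simp
    qed
    show ?thesis using N[OF SC] col row unfolding e_def by blast
  qed
  then show ?thesis using RC r by blast
qed

section \<open>The Baire category argument\<close>

theorem corollary5p13:
  fixes p :: real
  assumes "2 < p"
  shows "(\<forall>G. G \<subseteq> lp_contractions p \<and> gdelta_in (lp_SOT_star p) G \<and> dense_in (lp_SOT p) G
             \<longrightarrow> comeager_in (lp_SOT p) G)
       \<and> (\<forall>A. A \<subseteq> lp_contractions p \<and> comeager_in (lp_SOT_star p) A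
             \<longrightarrow> comeager_in (lp_SOT p) A)"
proof (intro conjI allI impI)
  have p1: "p \<ge> 1" using assms by simp
  interpret M: Metric_space "lp_contractions p" "lp_opdist p" by (rule Metric_space_lp_opdist[OF p1])
  note top = topspace_lp_SOT[OF p1]
  have interior: "lp_SOT p interior_of V \<noteq> {}" if V: "openin (lp_SOT_star p) V" "V \<noteq> {}" for V
  proof -
    obtain R r where R: "R \<in> lp_contractions p" "r > 0"
      and r: "\<And>S. S \<in> lp_contractions p \<Longrightarrow> lp_opdist p S R < r \<Longrightarrow> S \<in> V"
      using SOT_star_open_contains_SOT_ball[OF assms V] by blast
    have "openin (lp_SOT p) (M.mball R r)" unfolding lp_SOT_eq_mtopology[OF p1] by simp
    moreover have "M.mball R r \<subseteq> V" using r by (auto simp: M.commute)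
    moreover have "R \<in> M.mball R r" using R by simp
    ultimately show ?thesis using interior_of_maximal by blast
  qed
  show part1: "comeager_in (lp_SOT p) G"
    if G: "G \<subseteq> lp_contractions p \<and> gdelta_in (lp_SOT_star p) G \<and> dense_in (lp_SOT p) G" for G
  proof -
    obtain \<U> where \<U>: "countable \<U>" "\<And>V. V \<in> \<U> \<Longrightarrow> openin (lp_SOT_star p) V" "\<Inter>\<U> = G"
      using G by (auto simp: gdelta_in_alt intersection_of_def)
    \<comment> \<open>Inserting the whole space keeps the intersection inside the carrier when
      \<open>\<U>\<close> is empty.\<close>
    define \<W> where "\<W> = insert (lp_contractions p) ((\<lambda>V. lp_SOT p interior_of V) ` \<U>)"
    \<comment> \<open>A nonempty SOT-open \<open>U\<close> meets \<open>G\<close>, so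
      \<open>V \<inter> U\<close> is nonempty and \<open>SOT\<^sup>*\<close>-open. It therefore has
      nonempty SOT-interior, which is the SOT-interior of \<open>V\<close> intersected with
      \<open>U\<close>.\<close>
    have dense: "lp_SOT p closure_of (lp_SOT p interior_of V) = topspace (lp_SOT p)" if V: "V \<in> \<U>" for V
      unfolding dense_intersects_open
    proof (intro allI impI)
      fix U assume U: "openin (lp_SOT p) U \<and> U \<noteq> {}"
      have "\<forall>W. openin (lp_SOT p) W \<and> W \<noteq> {} \<longrightarrow> G \<inter> W \<noteq> {}"
        using G unfolding dense_in_def dense_intersects_open by blast
      then have "G \<inter> U \<noteq> {}" using U by blast
      then have "V \<inter> U \<noteq> {}" using \<U>(3) V by blast
      moreover have "openin (lp_SOT_star p) (V \<inter> U)"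
        using \<U>(2)[OF V] openin_lp_SOT_star_if_openin_lp_SOT[OF p1] U by (intro openin_Int) auto
      ultimately have "lp_SOT p interior_of (V \<inter> U) \<noteq> {}" by (intro interior)
      then show "(lp_SOT p interior_of V) \<inter> U \<noteq> {}"
        using U by (auto simp: interior_of_Int interior_of_openin)
    qed
    have W: "openin (lp_SOT p) W \<and> lp_SOT p closure_of W = topspace (lp_SOT p)" if "W \<in> \<W>" for W
      using that dense closure_of_topspace[of "lp_SOT p"] openin_topspace[of "lp_SOT p"]
      by (auto simp: \<W>_def top)
    have cW: "countable \<W>" using \<U>(1) by (simp add: \<W>_def)
    have "lp_SOT p closure_of \<Inter>\<W> = topspace (lp_SOT p)"
      using Baire_category[OF disjI1[OF completely_metrizable_space_lp_SOT[OF p1]] cW W] .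
    moreover have sub: "\<Inter>\<W> \<subseteq> lp_contractions p" by (auto simp: \<W>_def)
    moreover have "gdelta_in (lp_SOT p) (\<Inter>\<W>)"
      unfolding gdelta_in_alt intersection_of_def top using sub cW W by blast
    moreover have "\<Inter>\<W> \<subseteq> G"
    proof
      fix T assume "T \<in> \<Inter>\<W>"
      then have "T \<in> V" if "V \<in> \<U>" for V
        using that interior_of_subset[of "lp_SOT p" V] by (auto simp: \<W>_def)
      then show "T \<in> G" using \<U>(3) by blast
    qed
    ultimately show ?thesis using G unfolding comeager_in_def dense_in_def top by blast
  qed
  show "comeager_in (lp_SOT p) A"
    if A: "A \<subseteq> lp_contractions p \<and> comeager_in (lp_SOT_star p) A" for A
  proof -
    obtain G where G: "gdelta_in (lp_SOT_star p) G" "dense_in (lp_SOT_star p) G" "G \<subseteq> A"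
      using A by (auto simp: comeager_in_def)
    \<comment> \<open>Every SOT-open set is \<open>SOT\<^sup>*\<close>-open, so density passes to
      the coarser topology and the first part applies to \<open>G\<close>.\<close>
    have "dense_in (lp_SOT p) G"
      unfolding dense_in_def dense_intersects_open
      unfolding top
    proof (intro conjI allI impI)
      show "G \<subseteq> lp_contractions p" using G(3) A by blast
      have dense: "\<forall>U. openin (lp_SOT_star p) U \<and> U \<noteq> {} \<longrightarrow> G \<inter> U \<noteq> {}"
        using G(2) unfolding dense_in_def dense_intersects_open by (rule conjunct2)
      show "G \<inter> U \<noteq> {}" if "openin (lp_SOT p) U \<and> U \<noteq> {}" for U
        using that openin_lp_SOT_star_if_openin_lp_SOT[OF p1, of U] by (intro dense[rule_format]) blast
    qed
    moreover have "G \<subseteq> lp_contractions p" using G(3) A by blast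
    ultimately have "comeager_in (lp_SOT p) G" using G(1) by (intro part1) blast
    then show ?thesis using G(3) A unfolding comeager_in_def top by blast
  qed
qed

end
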